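(* Let $M$ be a Minsky machine with unsolvable halting problem, let $p$ be a prime, and let $G(M)$ be the associated Kharlampovich group, a finitely presented solvable group with unsolvable Word Problem which is generated by finite sets $L_0,L_1,L_2$ and has the structure described in the context. Then $G(M)$ has computable F\o lner sets.
   Context: For a group $\Gamma$ generated by a finite set $X$, let $\pi_{\Gamma,X}\colon \mathbb F_X\to\Gamma$ be the canonical epimorphism from the free group on $X$. For a positive integer $n$, an $n$-F\o lner set of $\Gamma$ (with respect to $X$) is a non-empty finite subset $F\subset\Gamma$ with $\frac{|F\setminus xF|}{|F|}\le n^{-1}$ for all $x\in X$. $\Gamma$ has computable F\o lner sets (with respect to $X$) if there is an algorithm which, on input $n$, outputs a finite subset $F\subset\mathbb F_X$ such that $\pi_{\Gamma,X}(F)$ is $n$-F\o lner for $\Gamma$. This property does not depend on the choice of the finite generating set. Kharlampovich groups. For a Minsky machine $M$ with unsolvable halting problem and a fixed prime $p$, the Kharlampovich group $G(M)$ (in the description of Kharlampovich, Myasnikov and Sapir) is a finitely presented solvable group with unsolvable Word Problem, generated by $L_0\cup L_1\cup L_2$ with $L_0,L_1,L_2$ finite pairwise disjoint sets, with the following structure. Put $H_j:=\langle L_j\rangle$ for $j=0,1,2$ and $H:=\langle L_1\cup L_2\rangle$; write $K^{G}$ for the normal closure of a subgroup $K$ in a group $G$; semidirect products are internal (normal factor on the left). Then: (1) $H_0,H_1,H_2$ are abelian; (2) $H_0$ and $H_1$ are of exponent $p$; (3) $H_1^{H}$ is abelian of exponent $p$; (4) $H=H_1^{H}\rtimes H_2$;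 (5) $H_0^{G(M)}$ is abelian of exponent $p$; (6) $G(M)=H_0^{G(M)}\rtimes H$. *)

theory Defs
  imports
    "HOL-Algebra.Solvable_Groups"
    "HOL-Computational_Algebra.Primes"
    "HOL-Library.Nat_Bijection"
    "HOL-Library.Countable_Set"
    Complex_Main
begin

section \<open>Computable functions\<close>

text \<open>Programs for the partial recursive functions. In \<open>Prec f g\<close> and \<open>Mu f\<close> the first argument
  is the recursion (resp. search) variable.\<close>

datatype recf =
    Zero
  | Succ
  | Proj nat
  | Comp recf "recf list"
  | Prec recf recf
  | Mu recf

inductive computes :: "recf \<Rightarrow> nat list \<Rightarrow> nat \<Rightarrow> bool" where
  zero: "computes Zero xs 0"
| succ: "computes Succ [x] (Suc x)"
| proj: "i < length xs \<Longrightarrow> computes (Proj i) xs (xs ! i)"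
| comp: "list_all2 (\<lambda>g y. computes g xs y) gs ys \<Longrightarrow> computes f ys z \<Longrightarrow> computes (Comp f gs) xs z"
| prec_0: "computes f xs y \<Longrightarrow> computes (Prec f g) (0 # xs) y"
| prec_Suc: "computes (Prec f g) (n # xs) r \<Longrightarrow> computes g (n # r # xs) y \<Longrightarrow>
    computes (Prec f g) (Suc n # xs) y"
| mu: "(\<forall>k<n. \<exists>y. computes f (k # xs) (Suc y)) \<Longrightarrow> computes f (n # xs) 0 \<Longrightarrow>
    computes (Mu f) xs n"

lemma computes_deterministic: "computes r xs y \<Longrightarrow> computes r xs z \<Longrightarrow> z = y"
proof (induction arbitrary: z rule: computes.induct)
  case (comp xs gs ys f y)
  from comp.prems obtain ys' where ys': "list_all2 (\<lambda>g y. computes g xs y) gs ys'" "computes f ys' z"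
    by (cases rule: computes.cases) auto
  have "ys' = ys"
    using comp.IH(1) ys'(1)
    by (auto simp: list_all2_conv_all_nth intro!: nth_equalityI)
  with ys' comp.IH(2) show ?case by blast
next
  case (mu n f xs)
  from mu.prems have z: "\<forall>k<z. \<exists>y. computes f (k # xs) (Suc y)" "computes f (z # xs) 0"
    by (cases rule: computes.cases; blast)+
  show ?case
  proof (rule linorder_cases[of z n])
    assume "z < n" with mu.IH(1) z(2) show ?thesis by fastforce
  next
    assume "n < z" with mu.IH(2) z(1) show ?thesis by fastforce
  qed
next
  case (prec_Suc f g n xs r y)
  from prec_Suc.prems obtain r' where r': "computes (Prec f g) (n # xs) r'" "computes g (n # r' # xs) z"
    by (cases rule: computes.cases) auto
  with prec_Suc.IH(1) have "r' = r" by blast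
  with r' prec_Suc.IH(2) show ?case by blast
next
  case (prec_0 f xs y g)
  from prec_0.prems have "computes f xs z" by (cases rule: computes.cases) auto
  with prec_0.IH show ?case by blast
next
  case (zero xs)
  then show ?case by (cases rule: computes.cases) auto
next
  case (succ x)
  then show ?case by (cases rule: computes.cases) auto
next
  case (proj i xs)
  from proj.prems show ?case by (cases rule: computes.cases) auto
qed

definition computable :: "(nat \<Rightarrow> nat) \<Rightarrow> bool" where
  "computable f \<longleftrightarrow> (\<exists>r. \<forall>n. computes r [n] (f n))"

definition decidable :: "nat set \<Rightarrow> bool" where
  "decidable A \<longleftrightarrow> computable (\<lambda>n. of_bool (n \<in> A))"


section \<open>Minsky machines\<close>

text \<open>\<open>Add k j\<close>: add a coin to glass \<open>k\<close>, go to state \<open>j\<close>.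
  \<open>Take k i j\<close>: if glass \<open>k\<close> is non-empty, take a coin from it and go to state \<open>i\<close>;
  otherwise go to state \<open>j\<close>.\<close>

datatype command = Add nat nat | Take nat nat nat

text \<open>The states are the positions in the program, and every position beyond its end is a
  stop state. A configuration consists of a state and the list of contents of the glasses.\<close>

record minsky_machine =
  glasses :: nat
  program :: "command list"

fun command_glass :: "command \<Rightarrow> nat" where
  "command_glass (Add k j) = k"
| "command_glass (Take k i j) = k"

definition is_minsky_machine :: "minsky_machine \<Rightarrow> bool" where
  "is_minsky_machine M \<longleftrightarrow> (\<forall>c \<in> set (program M). command_glass c < glasses M)"

type_synonym configuration = "nat \<times> nat list"

fun execute :: "command \<Rightarrow> nat list \<Rightarrow> configuration" where
  "execute (Add k j) v = (j, v[k := Suc (v ! k)])"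
| "execute (Take k i j) v = (if v ! k > 0 then (i, v[k := v ! k - 1]) else (j, v))"

definition stopped :: "minsky_machine \<Rightarrow> configuration \<Rightarrow> bool" where
  "stopped M c \<longleftrightarrow> fst c \<ge> length (program M)"

definition step :: "minsky_machine \<Rightarrow> configuration \<Rightarrow> configuration" where
  "step M c = (if stopped M c then c else execute (program M ! fst c) (snd c))"

definition halts :: "minsky_machine \<Rightarrow> configuration \<Rightarrow> bool" where
  "halts M c \<longleftrightarrow> (\<exists>t. stopped M ((step M ^^ t) c))"

definition halting_problem :: "minsky_machine \<Rightarrow> nat set" where
  "halting_problem M =
    {prod_encode (s, list_encode v) | s v. length v = glasses M \<and> halts M (s, v)}"


section \<open>Free groups\<close>

text \<open>The letter \<open>(x, True)\<close> stands for \<open>x\<close> and \<open>(x, False)\<close> for its inverse. The elements of the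
  free group are the freely reduced words; \<open>reduce w\<close> is the element represented by \<open>w\<close>.\<close>

type_synonym 'x word = "('x \<times> bool) list"

definition inv_letter :: "'x \<times> bool \<Rightarrow> 'x \<times> bool" where
  "inv_letter a = (fst a, \<not> snd a)"

definition words :: "'x set \<Rightarrow> 'x word set" where
  "words X = {w. fst ` set w \<subseteq> X}"

definition reduced :: "'x word \<Rightarrow> bool" where
  "reduced w \<longleftrightarrow> successively (\<lambda>a b. b \<noteq> inv_letter a) w"

fun push :: "'x \<times> bool \<Rightarrow> 'x word \<Rightarrow> 'x word" where
  "push a [] = [a]"
| "push a (b # w) = (if b = inv_letter a then w else a # b # w)"

definition reduce :: "'x word \<Rightarrow> 'x word" where
  "reduce w = foldr push w []"

definition free_group :: "'x set \<Rightarrow> 'x word monoid" where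
  "free_group X =
    \<lparr>carrier = {w \<in> words X. reduced w}, monoid.mult = (\<lambda>u v. reduce (u @ v)), one = []\<rparr>"

definition letter_value :: "('a, 'b) monoid_scheme \<Rightarrow> 'a \<times> bool \<Rightarrow> 'a" where
  "letter_value G a = (if snd a then fst a else inv\<^bsub>G\<^esub> (fst a))"

text \<open>The canonical epimorphism from the free group on a generating set of \<open>G\<close> onto \<open>G\<close>.\<close>

definition canonical_epi :: "('a, 'b) monoid_scheme \<Rightarrow> 'a word \<Rightarrow> 'a" where
  "canonical_epi G w = foldr (\<lambda>a g. letter_value G a \<otimes>\<^bsub>G\<^esub> g) w \<one>\<^bsub>G\<^esub>"

lemma inv_letter_inv_letter [simp]: "inv_letter (inv_letter a) = a"
  by (simp add: inv_letter_def)

lemma inv_letter_neq [simp]: "inv_letter a \<noteq> a" "a \<noteq> inv_letter a"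
  by (simp_all add: inv_letter_def prod_eq_iff)

lemma inv_letter_swap: "a = inv_letter b \<longleftrightarrow> b = inv_letter a"
  by auto

lemma reduced_Nil [simp]: "reduced []"
  by (simp add: reduced_def)

lemma reduced_Cons:
  "reduced (a # w) \<longleftrightarrow> (case w of [] \<Rightarrow> True | b # _ \<Rightarrow> b \<noteq> inv_letter a) \<and> reduced w"
  by (cases w) (auto simp: reduced_def)

lemma reduced_push: "reduced w \<Longrightarrow> reduced (push a w)"
  by (cases w) (auto simp: reduced_Cons split: list.splits)

lemma push_push_inv: "reduced w \<Longrightarrow> push a (push (inv_letter a) w) = w"
proof (cases w)
  case (Cons b v)
  assume "reduced w"
  with Cons show ?thesis by (cases v) (auto simp: reduced_Cons)
qed auto

lemma push_eq_Cons: "reduced (a # w) \<Longrightarrow> push a w = a # w"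
  by (cases w) (auto simp: reduced_Cons)

lemma reduced_foldr_push: "reduced w \<Longrightarrow> reduced (foldr push u w)"
  by (induction u) (auto intro: reduced_push)

lemma reduced_reduce: "reduced (reduce w)"
  by (simp add: reduce_def reduced_foldr_push)

lemma reduce_reduced: "reduced w \<Longrightarrow> reduce w = w"
  by (induction w) (auto simp: reduce_def reduced_Cons push_eq_Cons)

lemma reduce_append: "reduce (u @ v) = foldr push u (reduce v)"
  by (simp add: reduce_def)

lemma foldr_push_push:
  assumes "reduced w" shows "foldr push (push a u) w = push a (foldr push u w)"
proof (cases u)
  case (Cons b v)
  then show ?thesis
    using push_push_inv[of "foldr push v w" a] assms by (auto simp: reduced_foldr_push)
qed auto

lemma foldr_push_reduce: "reduced w \<Longrightarrow> foldr push (reduce u) w = foldr push u w"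
  by (induction u) (auto simp: reduce_def foldr_push_push)

lemma reduce_append_reduce: "reduce (reduce u @ v) = reduce (u @ v)"
  "reduce (u @ reduce v) = reduce (u @ v)"
  by (simp_all add: reduce_append foldr_push_reduce reduced_reduce reduce_reduced)

lemma words_simps [simp]:
  "[] \<in> words X" "a # w \<in> words X \<longleftrightarrow> fst a \<in> X \<and> w \<in> words X"
  "u @ v \<in> words X \<longleftrightarrow> u \<in> words X \<and> v \<in> words X"
  by (auto simp: words_def)

lemma words_push: "fst a \<in> X \<Longrightarrow> w \<in> words X \<Longrightarrow> push a w \<in> words X"
  by (cases w) auto

lemma words_reduce: "w \<in> words X \<Longrightarrow> reduce w \<in> words X"
  by (induction w) (auto simp: reduce_def intro!: words_push)

lemma reduce_inverse: "reduce (rev (map inv_letter w) @ w) = []"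
proof (induction w)
  case (Cons a w)
  have "push (inv_letter a) (push a (reduce w)) = reduce w"
    using push_push_inv[of "reduce w" "inv_letter a"] by (simp add: reduced_reduce)
  with Cons show ?case by (simp add: reduce_def)
qed (simp add: reduce_def)

lemma words_inverse: "w \<in> words X \<Longrightarrow> rev (map inv_letter w) \<in> words X"
  by (induction w) (auto simp: inv_letter_def)

lemma group_free_group: "group (free_group X)"
proof (rule groupI)
  fix x assume x: "x \<in> carrier (free_group X)"
  show "\<exists>y\<in>carrier (free_group X). y \<otimes>\<^bsub>free_group X\<^esub> x = \<one>\<^bsub>free_group X\<^esub>"
    using x by (intro bexI[of _ "reduce (rev (map inv_letter x))"])
      (auto simp: free_group_def reduce_append_reduce reduce_inverse reduced_reduce
        words_reduce words_inverse)
qed (auto simp: free_group_def reduced_reduce words_reduce reduce_append_reduce reduce_reduced)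

context group
begin

lemma letter_value_closed: "X \<subseteq> carrier G \<Longrightarrow> fst a \<in> X \<Longrightarrow> letter_value G a \<in> carrier G"
  by (auto simp: letter_value_def)

lemma letter_value_inv_letter:
  "X \<subseteq> carrier G \<Longrightarrow> fst a \<in> X \<Longrightarrow> letter_value G (inv_letter a) = inv (letter_value G a)"
  by (auto simp: letter_value_def inv_letter_def)

lemma canonical_epi_closed:
  "X \<subseteq> carrier G \<Longrightarrow> w \<in> words X \<Longrightarrow> canonical_epi G w \<in> carrier G"
  by (induction w) (auto simp: canonical_epi_def letter_value_closed)

lemma canonical_epi_append:
  assumes "X \<subseteq> carrier G" "u \<in> words X" "v \<in> words X"
  shows "canonical_epi G (u @ v) = canonical_epi G u \<otimes> canonical_epi G v"
  using assms(2)
proof (induction u)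
  case Nil
  then show ?case using canonical_epi_closed[OF assms(1,3)] by (simp add: canonical_epi_def)
next
  case (Cons a u)
  then show ?case
    using canonical_epi_closed[OF assms(1,3)] canonical_epi_closed[OF assms(1), of u]
      letter_value_closed[OF assms(1), of a]
    by (simp add: canonical_epi_def m_assoc)
qed

lemma canonical_epi_push:
  assumes "X \<subseteq> carrier G" "fst a \<in> X" "w \<in> words X"
  shows "canonical_epi G (push a w) = letter_value G a \<otimes> canonical_epi G w"
proof (cases w)
  case (Cons b v)
  then show ?thesis
    using assms letter_value_closed[OF assms(1,2)] canonical_epi_closed[OF assms(1), of v]
      letter_value_inv_letter[OF assms(1,2)]
    by (auto simp: canonical_epi_def m_assoc[symmetric])
qed (auto simp: canonical_epi_def)

lemma canonical_epi_reduce: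
  assumes "X \<subseteq> carrier G" "w \<in> words X"
  shows "canonical_epi G (reduce w) = canonical_epi G w"
  using assms(2)
proof (induction w)
  case (Cons a w)
  then show ?case
    using canonical_epi_push[OF assms(1), of a "reduce w"] words_reduce[of w X]
    by (simp add: reduce_def) (simp add: canonical_epi_def)
qed (simp add: reduce_def)

lemma canonical_epi_hom:
  assumes "X \<subseteq> carrier G"
  shows "canonical_epi G \<in> hom (free_group X) G"
  by (rule homI) (auto simp: free_group_def canonical_epi_closed[OF assms]
      canonical_epi_reduce[OF assms] canonical_epi_append[OF assms])

end


section \<open>Finitely presented groups and the word problem\<close>

definition normal_closure :: "('a, 'b) monoid_scheme \<Rightarrow> 'a set \<Rightarrow> 'a set" where
  "normal_closure G K =
    generate G {g \<otimes>\<^bsub>G\<^esub> k \<otimes>\<^bsub>G\<^esub> inv\<^bsub>G\<^esub> g | g k. g \<in> carrier G \<and> k \<in> K}"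

definition finite_generating_set :: "('a, 'b) monoid_scheme \<Rightarrow> 'a set \<Rightarrow> bool" where
  "finite_generating_set G X \<longleftrightarrow> finite X \<and> X \<subseteq> carrier G \<and> generate G X = carrier G"

definition finitely_presented :: "('a, 'b) monoid_scheme \<Rightarrow> bool" where
  "finitely_presented G \<longleftrightarrow>
    (\<exists>X R. finite_generating_set G X \<and> finite R \<and> R \<subseteq> carrier (free_group X) \<and>
      kernel (free_group X) G (canonical_epi G) = normal_closure (free_group X) R)"

text \<open>Words over a finite set \<open>X\<close>, and finite lists of words, are the inputs and outputs of
  algorithms via their codes; \<open>to_nat_on X\<close> numbers \<open>X\<close> by \<open>0, \<dots>, card X - 1\<close>.\<close>

definition word_code :: "'x set \<Rightarrow> 'x word \<Rightarrow> nat" where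
  "word_code X w = list_encode (map (\<lambda>a. 2 * to_nat_on X (fst a) + of_bool (snd a)) w)"

definition word_list_code :: "'x set \<Rightarrow> 'x word list \<Rightarrow> nat" where
  "word_list_code X ws = list_encode (map (word_code X) ws)"

definition solvable_word_problem :: "('a, 'b) monoid_scheme \<Rightarrow> 'a set \<Rightarrow> bool" where
  "solvable_word_problem G X \<longleftrightarrow>
    decidable {word_code X w | w. w \<in> words X \<and> canonical_epi G w = \<one>\<^bsub>G\<^esub>}"


section \<open>Computable Folner sets\<close>

definition Folner_set :: "('a, 'b) monoid_scheme \<Rightarrow> 'a set \<Rightarrow> nat \<Rightarrow> 'a set \<Rightarrow> bool" where
  "Folner_set G X n F \<longleftrightarrow> F \<noteq> {} \<and> finite F \<and> F \<subseteq> carrier G \<and>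
    (\<forall>x\<in>X. real (card (F - (x <#\<^bsub>G\<^esub> F))) / real (card F) \<le> 1 / real n)"

text \<open>The algorithm outputs a finite subset of the free group on \<open>X\<close> as a list of words that
  represent its elements.\<close>

definition computable_Folner_sets :: "('a, 'b) monoid_scheme \<Rightarrow> 'a set \<Rightarrow> bool" where
  "computable_Folner_sets G X \<longleftrightarrow>
    (\<exists>f. computable f \<and>
      (\<forall>n\<ge>1. \<exists>ws. set ws \<subseteq> words X \<and> f n = word_list_code X ws \<and>
        Folner_set G X n (canonical_epi G ` reduce ` set ws)))"


section \<open>The structure of Kharlampovich groups\<close>

definition has_exponent :: "('a, 'b) monoid_scheme \<Rightarrow> nat \<Rightarrow> bool" where
  "has_exponent G m \<longleftrightarrow> 0 < m \<and> (\<forall>x\<in>carrier G. x [^]\<^bsub>G\<^esub> m = \<one>\<^bsub>G\<^esub>) \<and>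
    (\<forall>k. 0 < k \<and> k < m \<longrightarrow> (\<exists>x\<in>carrier G. x [^]\<^bsub>G\<^esub> k \<noteq> \<one>\<^bsub>G\<^esub>))"

definition internal_semidirect :: "('a, 'b) monoid_scheme \<Rightarrow> 'a set \<Rightarrow> 'a set \<Rightarrow> bool" where
  "internal_semidirect G N K \<longleftrightarrow>
    N \<lhd> G \<and> subgroup K G \<and> N <#>\<^bsub>G\<^esub> K = carrier G \<and> N \<inter> K = {\<one>\<^bsub>G\<^esub>}"

abbreviation subgroup_of :: "('a, 'b) monoid_scheme \<Rightarrow> 'a set \<Rightarrow> ('a, 'b) monoid_scheme" where
  "subgroup_of G K \<equiv> G\<lparr>carrier := K\<rparr>"

text \<open>\<open>H\<close> below is the subgroup generated by \<open>L1 \<union> L2\<close>, \<open>N0\<close> the normal closure of \<open>H0\<close> in the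
  whole group, and \<open>N1\<close> the normal closure of \<open>H1\<close> in \<open>H\<close> only.\<close>

definition kharlampovich_structure ::
    "nat \<Rightarrow> ('a, 'b) monoid_scheme \<Rightarrow> 'a set \<Rightarrow> 'a set \<Rightarrow> 'a set \<Rightarrow> bool" where
  "kharlampovich_structure p G L0 L1 L2 \<longleftrightarrow>
    (let H0 = generate G L0; H1 = generate G L1; H2 = generate G L2;
         H = generate G (L1 \<union> L2);
         N0 = normal_closure G H0;
         N1 = normal_closure (subgroup_of G H) H1
     in comm_group (subgroup_of G H0) \<and> comm_group (subgroup_of G H1) \<and>
        comm_group (subgroup_of G H2) \<and>
        has_exponent (subgroup_of G H0) p \<and> has_exponent (subgroup_of G H1) p \<and>
        comm_group (subgroup_of G N1) \<and> has_exponent (subgroup_of G N1) p \<and>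
        internal_semidirect (subgroup_of G H) N1 H2 \<and>
        comm_group (subgroup_of G N0) \<and> has_exponent (subgroup_of G N0) p \<and>
        internal_semidirect G N0 H)"

end

theory Submission
  imports Defs "HOL-Algebra.Zassenhaus"
begin

text \<open>Write \<open>N0\<close> for the normal closure of \<open>H0\<close>, \<open>N1\<close> for that of \<open>H1\<close> in \<open>H\<close>, and \<open>H2\<close> for the
  top factor. An undecidable word problem is no obstacle to computing Folner sets, because words
  for the elements of the set can be written down without deciding which of them are equal.

  The set is a product \<open>F2 F1 F0\<close> with \<open>F2 \<subseteq> H2\<close>, \<open>F1 \<subseteq> N1\<close>, \<open>F0 \<subseteq> N0\<close>. Moving a generator \<open>x\<close> past \<open>s\<close>
  from the left turns it into the conjugate \<open>inv s \<otimes> x \<otimes> s\<close>. So let \<open>F1\<close> be generated by the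
  conjugates of the elements of \<open>L1\<close> by \<open>F2\<close>, and \<open>F0\<close> by the conjugates of the elements of \<open>L0\<close> by
  \<open>F2 F1\<close>. Both are finitely generated subgroups of an abelian group of exponent \<open>p\<close>, hence
  consist of the products of powers of the generators with exponents below \<open>p\<close>, which is a finite
  list of words whatever the relations are. With these choices left multiplication by \<open>L0\<close> and \<open>L1\<close>
  maps \<open>F2 F1 F0\<close> onto itself, and since \<open>H2\<close> meets \<open>N0 N1\<close> trivially, a left translation by an
  element of \<open>L2\<close> moves exactly the proportion of \<open>F2 F1 F0\<close> that it moves of \<open>F2\<close>. This is
  \<open>Folner_set_tower\<close>.

  It remains to find \<open>F2\<close> in the finitely generated abelian group \<open>H2\<close>. It is a box of products
  \<open>x1^e1 \<dots> xr^er\<close> with \<open>ei < bi\<close>, where, as generators are added one at a time, \<open>bi\<close> is the order of the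
  new one modulo the subgroup generated by the previous ones if that is finite, and a multiple of
  \<open>n\<close> otherwise. Exponents are then unique, so the boundary of the box can be counted
  (\<open>abelian_Folner_boxes\<close>). The orders and the factor
  depend only on the group, so an algorithm may have them built in.

  Finally, the list of words is a primitive recursive function of \<open>n\<close>. For this, computability is
  transported to functions on encoded pairs and lists (\<open>effective\<close>), where iteration and folding are
  enough to form products, powers and conjugates of lists of words.\<close>

section \<open>Computable functions on numbers\<close>

definition computable2 :: "(nat \<Rightarrow> nat \<Rightarrow> nat) \<Rightarrow> bool" where
  "computable2 f \<longleftrightarrow> (\<exists>r. \<forall>x y. computes r [x, y] (f x y))"

lemma computable_const: "computable (\<lambda>_. c)"
proof (induction c)
  case 0
  show ?case unfolding computable_def by (blast intro: computes.zero)
next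
  case (Suc c)
  then obtain r where "\<forall>n. computes r [n] c" unfolding computable_def by blast
  then have "computes (Comp Succ [r]) [n] (Suc c)" for n
    by (intro computes.comp[of _ _ "[c]"] computes.succ) simp
  then show ?case unfolding computable_def by blast
qed

lemma computable_id: "computable (\<lambda>n. n)"
  unfolding computable_def using computes.proj[of 0 "[n]" for n] by (intro exI[of _ "Proj 0"]) simp

lemma computable_Suc: "computable Suc"
  unfolding computable_def by (blast intro: computes.succ)

lemma computable2_fst: "computable2 (\<lambda>x y. x)"
  unfolding computable2_def using computes.proj[of 0 "[x, y]" for x y]
  by (intro exI[of _ "Proj 0"]) simp

lemma computable2_snd: "computable2 (\<lambda>x y. y)"
  unfolding computable2_def using computes.proj[of 1 "[x, y]" for x y]
  by (intro exI[of _ "Proj 1"]) simp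

lemma computable_comp:
  assumes "computable f" "computable g" shows "computable (\<lambda>n. f (g n))"
proof -
  obtain r s where "\<forall>n. computes r [n] (f n)" "\<forall>n. computes s [n] (g n)"
    using assms unfolding computable_def by blast
  then have "computes (Comp r [s]) [n] (f (g n))" for n
    by (intro computes.comp[of _ _ "[g n]"]) simp_all
  then show ?thesis unfolding computable_def by blast
qed

lemma computable_comp2:
  assumes "computable2 f" "computable g" "computable h" shows "computable (\<lambda>n. f (g n) (h n))"
proof -
  obtain r s t where "\<forall>x y. computes r [x, y] (f x y)" "\<forall>n. computes s [n] (g n)"
    "\<forall>n. computes t [n] (h n)"
    using assms unfolding computable_def computable2_def by blast
  then have "computes (Comp r [s, t]) [n] (f (g n) (h n))" for n
    by (intro computes.comp[of _ _ "[g n, h n]"]) simp_all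
  then show ?thesis unfolding computable_def by blast
qed

lemma computable2_comp1:
  assumes "computable f" "computable2 g" shows "computable2 (\<lambda>x y. f (g x y))"
proof -
  obtain r s where "\<forall>n. computes r [n] (f n)" "\<forall>x y. computes s [x, y] (g x y)"
    using assms unfolding computable_def computable2_def by blast
  then have "computes (Comp r [s]) [x, y] (f (g x y))" for x y
    by (intro computes.comp[of _ _ "[g x y]"]) simp_all
  then show ?thesis unfolding computable2_def by blast
qed

lemma computable2_comp2:
  assumes "computable2 f" "computable2 g" "computable2 h"
  shows "computable2 (\<lambda>x y. f (g x y) (h x y))"
proof -
  obtain r s t where "\<forall>x y. computes r [x, y] (f x y)" "\<forall>x y. computes s [x, y] (g x y)"
    "\<forall>x y. computes t [x, y] (h x y)"
    using assms unfolding computable2_def by blast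
  then have "computes (Comp r [s, t]) [x, y] (f (g x y) (h x y))" for x y
    by (intro computes.comp[of _ _ "[g x y, h x y]"]) simp_all
  then show ?thesis unfolding computable2_def by blast
qed

lemma computable_rec_nat:
  assumes "computable2 g" shows "computable (rec_nat 0 g)"
proof -
  obtain r where r: "\<forall>x y. computes r [x, y] (g x y)"
    using assms unfolding computable2_def by blast
  have "computes (Prec Zero r) [n] (rec_nat 0 g n)" for n
    by (induction n) (use r in \<open>auto intro: computes.intros\<close>)
  then show ?thesis unfolding computable_def by blast
qed

lemma computable2_funpow:
  assumes "computable g" shows "computable2 (\<lambda>n x. (g ^^ n) x)"
proof -
  obtain r where r: "\<forall>n. computes r [n] (g n)"
    using assms unfolding computable_def by blast
  have "computes (Prec (Proj 0) (Comp r [Proj 1])) [n, x] ((g ^^ n) x)" for n x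
  proof (induction n)
    case 0
    show ?case using computes.proj[of 0 "[x]"] by (auto intro: computes.prec_0)
  next
    case (Suc n)
    have "computes (Comp r [Proj 1]) [n, (g ^^ n) x, x] (g ((g ^^ n) x))"
      using r computes.proj[of 1 "[n, (g ^^ n) x, x]"]
      by (intro computes.comp[of _ _ "[(g ^^ n) x]"]) simp_all
    with Suc show ?case by (auto intro: computes.prec_Suc)
  qed
  then show ?thesis unfolding computable2_def by blast
qed

lemma computable2_add: "computable2 (+)"
proof -
  have "(\<lambda>n x. (Suc ^^ n) x) = (+)"
  proof (intro ext)
    fix n x show "(Suc ^^ n) x = n + x" by (induction n) simp_all
  qed
  then show ?thesis using computable2_funpow[OF computable_Suc] by simp
qed

lemma computable_pred: "computable (\<lambda>n. n - 1)"
proof -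
  have "rec_nat 0 (\<lambda>x y. x) = (\<lambda>n::nat. n - 1)"
  proof
    fix n :: nat show "rec_nat 0 (\<lambda>x y. x) n = n - 1" by (cases n) simp_all
  qed
  then show ?thesis using computable_rec_nat[OF computable2_fst] by simp
qed

lemma computable2_diff: "computable2 (\<lambda>x y. y - x)"
proof -
  have "((\<lambda>n. n - 1) ^^ n) x = x - n" for n x :: nat by (induction n) simp_all
  then show ?thesis using computable2_funpow[OF computable_pred] by simp
qed

lemma computable_mult_const: "computable (\<lambda>n. c * n)"
proof (induction c)
  case (Suc c)
  then show ?case using computable_comp2[OF computable2_add computable_id] by simp
qed (simp add: computable_const)

lemma computable_triangle: "computable triangle"
proof -
  have "rec_nat 0 (\<lambda>n s. s + Suc n) = triangle"
  proof
    fix n show "rec_nat 0 (\<lambda>n s. s + Suc n) n = triangle n" by (induction n) simp_all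
  qed
  moreover have "computable (rec_nat 0 (\<lambda>n s. s + Suc n))"
    by (intro computable_rec_nat computable2_comp2[OF computable2_add]
        computable2_comp1[OF computable_Suc] computable2_fst computable2_snd)
  ultimately show ?thesis by simp
qed

lemma computable_prod_encode:
  assumes "computable f" "computable g" shows "computable (\<lambda>n. prod_encode (f n, g n))"
  unfolding prod_encode_def prod.case
  by (intro computable_comp2[OF computable2_add] computable_comp[OF computable_triangle] assms)

text \<open>The inverse of Cantor's pairing walks along the antidiagonals, and its two components are a
  simultaneous recursion. The index of the antidiagonal satisfies a recursion by itself, and both
  components can be read off from it.\<close>

definition diagonal :: "nat \<Rightarrow> nat" where
  "diagonal n = fst (prod_decode n) + snd (prod_decode n)"

lemma prod_decode_diagonal:
  "fst (prod_decode n) = n - triangle (diagonal n)"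
  "snd (prod_decode n) = diagonal n - fst (prod_decode n)"
proof -
  have "triangle (diagonal n) + fst (prod_decode n) = n"
    using prod_decode_inverse[of n] by (simp only: diagonal_def prod_encode_def split_beta)
  then show "fst (prod_decode n) = n - triangle (diagonal n)" by linarith
qed (simp add: diagonal_def)

lemma prod_decode_Suc:
  "prod_decode (Suc n) =
    (case prod_decode n of (a, b) \<Rightarrow> if b = 0 then (0, Suc a) else (Suc a, b - 1))"
proof -
  obtain a b where ab: "prod_decode n = (a, b)" by force
  have "n = prod_encode (a, b)" using ab by (metis prod_decode_inverse)
  then have "Suc n = prod_encode (if b = 0 then (0, Suc a) else (Suc a, b - 1))"
    by (cases b) (simp_all add: prod_encode_def)
  then show ?thesis using ab by (metis (no_types, lifting) case_prod_conv prod_encode_inverse)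
qed

text \<open>The subtrahend \<open>triangle (Suc (diagonal n)) - Suc n\<close> is the number of points that remain on the
  antidiagonal of \<open>n\<close>; the index increases exactly when it is zero.\<close>

lemma diagonal_Suc: "diagonal (Suc n) = diagonal n + (1 - (triangle (Suc (diagonal n)) - Suc n))"
proof -
  obtain a b where ab: "prod_decode n = (a, b)" by force
  then have n: "n = triangle (a + b) + a"
    using prod_decode_inverse[of n] by (simp add: prod_encode_def)
  have "triangle (Suc (a + b)) - Suc n = b" by (subst n) simp
  moreover have "diagonal n = a + b" "diagonal (Suc n) = (if b = 0 then Suc a else a + b)"
    using ab by (simp_all add: diagonal_def prod_decode_Suc)
  ultimately show ?thesis by simp
qed

lemma computable_diagonal: "computable diagonal"
proof -
  let ?g = "\<lambda>n s. s + (1 - (triangle (Suc s) - Suc n))"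
  have "rec_nat 0 ?g = diagonal"
  proof
    fix n show "rec_nat 0 ?g n = diagonal n"
    proof (induction n)
      case 0
      have "prod_decode 0 = (0, 0)" by (simp add: prod_decode_def prod_decode_aux.simps)
      then show ?case by (simp add: diagonal_def)
    next
      case (Suc n)
      then show ?case by (simp only: diagonal_Suc nat.rec)
    qed
  qed
  moreover have "computable2 (\<lambda>_ _. 1)"
    using computable2_comp1[OF computable_const computable2_fst] .
  then have "computable (rec_nat 0 ?g)"
    by (intro computable_rec_nat computable2_comp2[OF computable2_add]
        computable2_comp2[OF computable2_diff] computable2_comp1[OF computable_Suc]
        computable2_comp1[OF computable_triangle] computable2_fst computable2_snd)
  ultimately show ?thesis by simp
qed

lemma computable_fst_prod_decode: "computable (\<lambda>n. fst (prod_decode n))"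
proof -
  have "computable (\<lambda>n. n - triangle (diagonal n))"
    by (rule computable_comp2[OF computable2_diff
          computable_comp[OF computable_triangle computable_diagonal] computable_id])
  then show ?thesis by (simp only: prod_decode_diagonal(1))
qed

lemma computable_snd_prod_decode: "computable (\<lambda>n. snd (prod_decode n))"
proof -
  have "computable (\<lambda>n. diagonal n - fst (prod_decode n))"
    by (rule computable_comp2[OF computable2_diff computable_fst_prod_decode computable_diagonal])
  then show ?thesis by (simp only: prod_decode_diagonal(2))
qed

text \<open>Iterating \<open>(x, y) \<mapsto> (y, y)\<close> as often as the tested value says leaves \<open>x\<close> in the first component
  only if that value is \<open>0\<close>.\<close>

lemma computable_if_zero:
  assumes "computable c" "computable f" "computable g"
  shows "computable (\<lambda>n. if c n = 0 then f n else g n)"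
proof -
  define s where "s t = prod_encode (snd (prod_decode t), snd (prod_decode t))" for t
  have "computable s" unfolding s_def
    by (intro computable_prod_encode computable_snd_prod_decode)
  moreover have s: "(s ^^ k) (prod_encode (x, y)) = prod_encode (if k = 0 then x else y, y)" for k x y
    by (induction k) (simp_all add: s_def)
  ultimately have
    "computable (\<lambda>n. fst (prod_decode ((s ^^ c n) (prod_encode (f n, g n)))))"
    by (intro computable_comp[OF computable_fst_prod_decode] assms
        computable_comp2[OF computable2_funpow] computable_prod_encode)
  then show ?thesis by (simp add: s)
qed

section \<open>Effective functions on encoded data\<close>

text \<open>Only values of the tracking function on codes are constrained, and the encodings need not be
  injective. This suits words over all letters, where \<open>to_nat_on X\<close> is injective on \<open>X\<close> alone.\<close>

definition effective :: "('a \<Rightarrow> nat) \<Rightarrow> ('b \<Rightarrow> nat) \<Rightarrow> ('a \<Rightarrow> 'b) \<Rightarrow> bool" where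
  "effective ea eb f \<longleftrightarrow> (\<exists>g. computable g \<and> (\<forall>a. g (ea a) = eb (f a)))"

definition pair_code :: "('a \<Rightarrow> nat) \<Rightarrow> ('b \<Rightarrow> nat) \<Rightarrow> 'a \<times> 'b \<Rightarrow> nat" where
  "pair_code ea eb t = prod_encode (ea (fst t), eb (snd t))"

definition list_code :: "('a \<Rightarrow> nat) \<Rightarrow> 'a list \<Rightarrow> nat" where
  "list_code e xs = list_encode (map e xs)"

lemma effective_const: "effective ea eb (\<lambda>_. c)"
  unfolding effective_def by (intro exI[of _ "\<lambda>_. eb c"]) (simp add: computable_const)

lemma effective_id: "effective ea ea (\<lambda>a. a)"
  unfolding effective_def by (intro exI[of _ "\<lambda>n. n"]) (simp add: computable_id)

lemma effective_computable: "computable g \<Longrightarrow> effective (\<lambda>n. n) (\<lambda>n. n) g"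
  unfolding effective_def by auto

lemma computable_effective:
  assumes "effective (\<lambda>n. n) e f" shows "computable (\<lambda>n. e (f n))"
proof -
  obtain g where "computable g" "\<forall>n. g n = e (f n)" using assms unfolding effective_def by blast
  then have "g = (\<lambda>n. e (f n))" by auto
  with \<open>computable g\<close> show ?thesis by simp
qed

lemma effective_comp:
  assumes "effective eb ec f" "effective ea eb g" shows "effective ea ec (\<lambda>a. f (g a))"
proof -
  obtain f' g' where "computable f'" "\<forall>b. f' (eb b) = ec (f b)" "computable g'" "\<forall>a. g' (ea a) = eb (g a)"
    using assms unfolding effective_def by blast
  then show ?thesis unfolding effective_def
    by (intro exI[of _ "\<lambda>n. f' (g' n)"]) (simp add: computable_comp)
qed

lemma effective_fst: "effective (pair_code ea eb) ea fst"
  unfolding effective_def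
  by (intro exI[of _ "\<lambda>n. fst (prod_decode n)"]) (simp add: computable_fst_prod_decode pair_code_def)

lemma effective_snd: "effective (pair_code ea eb) eb snd"
  unfolding effective_def
  by (intro exI[of _ "\<lambda>n. snd (prod_decode n)"]) (simp add: computable_snd_prod_decode pair_code_def)

lemma effective_Pair:
  assumes "effective ea eb f" "effective ea ec g"
  shows "effective ea (pair_code eb ec) (\<lambda>a. (f a, g a))"
proof -
  obtain f' g' where "computable f'" "\<forall>a. f' (ea a) = eb (f a)" "computable g'" "\<forall>a. g' (ea a) = ec (g a)"
    using assms unfolding effective_def by blast
  then show ?thesis unfolding effective_def
    by (intro exI[of _ "\<lambda>n. prod_encode (f' n, g' n)"])
      (simp add: computable_prod_encode pair_code_def)
qed

lemmas effective_proj = effective_fst effective_snd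
  effective_comp[OF effective_fst] effective_comp[OF effective_snd]

lemma effective_weaken: "effective ea eb f \<Longrightarrow> effective (pair_code ea ec) eb (\<lambda>t. f (fst t))"
  by (rule effective_comp[OF _ effective_fst])

text \<open>The iterated function may depend on the argument \<open>a\<close>, so the tracking function carries the code
  of \<open>a\<close> along in the state.\<close>

lemma effective_funpow:
  assumes f: "effective (pair_code ea es) es (\<lambda>t. f (fst t) (snd t))"
    and n: "effective ea (\<lambda>n. n) n" and s: "effective ea es s"
  shows "effective ea es (\<lambda>a. (f a ^^ n a) (s a))"
proof -
  from effective_Pair[OF effective_fst f] obtain g
    where g: "computable g" "g (pair_code ea es t) = pair_code ea es (fst t, f (fst t) (snd t))" for t
    unfolding effective_def by blast
  have iter: "(g ^^ k) (pair_code ea es (a, x)) = pair_code ea es (a, (f a ^^ k) x)" for k a x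
    by (induction k) (simp_all add: g)
  obtain n' where n': "computable n'" "\<forall>a. n' (ea a) = n a"
    using n unfolding effective_def by blast
  obtain i where i: "computable i" "\<forall>a. i (ea a) = pair_code ea es (a, s a)"
    using effective_Pair[OF effective_id s] unfolding effective_def by blast
  have "computable (\<lambda>m. (g ^^ n' m) (i m))"
    by (intro computable_comp2[OF computable2_funpow] g n' i)
  then have "effective ea (pair_code ea es) (\<lambda>a. (a, (f a ^^ n a) (s a)))"
    unfolding effective_def
    by (intro exI[of _ "\<lambda>m. (g ^^ n' m) (i m)"]) (simp add: n' i iter)
  from effective_comp[OF effective_snd this] show ?thesis by simp
qed

lemma effective_Cons:
  assumes "effective ea ex f" "effective ea (list_code ex) g"
  shows "effective ea (list_code ex) (\<lambda>a. f a # g a)"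
proof -
  obtain f' g' where "computable f'" "\<forall>a. f' (ea a) = ex (f a)"
    "computable g'" "\<forall>a. g' (ea a) = list_code ex (g a)"
    using assms unfolding effective_def by blast
  then show ?thesis unfolding effective_def
    by (intro exI[of _ "\<lambda>n. Suc (prod_encode (f' n, g' n))"])
      (simp add: computable_prod_encode computable_comp[OF computable_Suc] list_code_def)
qed

lemma effective_case_list:
  assumes g: "effective ea (list_code ex) g" and h: "effective ea eb h"
    and k: "effective (pair_code ea (pair_code ex (list_code ex))) eb
      (\<lambda>t. k (fst t) (fst (snd t)) (snd (snd t)))"
  shows "effective ea eb (\<lambda>a. case g a of [] \<Rightarrow> h a | x # xs \<Rightarrow> k a x xs)"
proof -
  obtain g' h' where g': "computable g'" "\<forall>a. g' (ea a) = list_code ex (g a)"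
    and h': "computable h'" "\<forall>a. h' (ea a) = eb (h a)"
    using g h unfolding effective_def by blast
  obtain k' where k': "computable k'"
    "\<forall>t. k' (pair_code ea (pair_code ex (list_code ex)) t) = eb (k (fst t) (fst (snd t)) (snd (snd t)))"
    using k unfolding effective_def by blast
  then have k'': "k' (prod_encode (ea a, prod_encode (ex x, list_code ex xs))) = eb (k a x xs)"
    for a x xs by (simp add: pair_code_def)
  have "computable (\<lambda>n. if g' n = 0 then h' n else k' (prod_encode (n, g' n - 1)))"
    by (intro computable_if_zero computable_comp[OF k'(1)] computable_prod_encode
        computable_comp[OF computable_pred] computable_id g' h')
  moreover have "(if g' (ea a) = 0 then h' (ea a) else k' (prod_encode (ea a, g' (ea a) - 1)))
      = eb (case g a of [] \<Rightarrow> h a | x # xs \<Rightarrow> k a x xs)" for a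
    using g' h' k'' by (cases "g a") (simp_all add: list_code_def)
  ultimately show ?thesis unfolding effective_def by blast
qed

lemma length_le_list_encode: "length xs \<le> list_encode xs"
proof (induction xs)
  case (Cons x xs)
  then show ?case using le_prod_encode_2[of "list_encode xs" x] by simp
qed simp

text \<open>A fold is an iteration on pairs of a remaining list and an accumulator, which is constant once
  the list is used up. So any number of steps from the length on will do, and the code of the list,
  which is at hand, is such a number.\<close>

lemma effective_fold:
  assumes f: "effective (pair_code ea (pair_code ex es)) es (\<lambda>t. f (fst t) (fst (snd t)) (snd (snd t)))"
    and xs: "effective ea (list_code ex) xs" and s: "effective ea es s"
  shows "effective ea es (\<lambda>a. fold (f a) (xs a) (s a))"
proof -
  define step where
    "step a t = (case fst t of [] \<Rightarrow> ([], snd t) | x # ys \<Rightarrow> (ys, f a x (snd t)))" for a t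
  \<comment> \<open>For \<open>k\<close> beyond the length this uses that \<open>step\<close> fixes states with an empty list.\<close>
  have step: "(step a ^^ k) (ys, z) = ([], fold (f a) ys z)" if "length ys \<le> k" for a k ys z
    using that
  proof (induction k arbitrary: ys z)
    case (Suc k)
    then show ?case
      by (cases ys) (simp_all add: funpow_Suc_right step_def del: funpow.simps)
  qed simp
  let ?e = "pair_code ea (pair_code (list_code ex) es)"
  let ?e' = "pair_code ?e (pair_code ex (list_code ex))"
  have state: "effective ?e es (\<lambda>t. snd (snd t))" "effective ?e (list_code ex) (\<lambda>t. fst (snd t))"
    by (rule effective_proj)+
  have "effective ?e' ea (\<lambda>t. fst (fst t))" by (rule effective_proj)+
  moreover have "effective ?e' ex (\<lambda>t. fst (snd t))" "effective ?e' (list_code ex) (\<lambda>t. snd (snd t))"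
    by (rule effective_proj)+
  ultimately have "effective ?e' (pair_code (list_code ex) es)
    (\<lambda>t. (snd (snd t), f (fst (fst t)) (fst (snd t)) (snd (snd (fst t)))))"
    using effective_comp[OF f effective_Pair[OF _ effective_Pair[OF _ effective_weaken[OF state(1)]]]]
    by (intro effective_Pair) simp_all
  then have "effective ?e (pair_code (list_code ex) es) (\<lambda>t. step (fst t) (snd t))"
    unfolding step_def
    by (rule effective_case_list[where k = "\<lambda>a x ys. (ys, f (fst a) x (snd (snd a)))",
          OF state(2) effective_Pair[OF effective_const state(1)]])
  moreover have "effective ea (\<lambda>n. n) (\<lambda>a. list_code ex (xs a))"
    using xs unfolding effective_def .
  ultimately have "effective ea (pair_code (list_code ex) es)
      (\<lambda>a. (step a ^^ list_code ex (xs a)) (xs a, s a))"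
    using effective_Pair[OF xs s] by (intro effective_funpow)
  moreover have "length (xs a) \<le> list_code ex (xs a)" for a
    using length_le_list_encode[of "map ex (xs a)"] by (simp add: list_code_def)
  ultimately show ?thesis
    using effective_comp[OF effective_snd] by (fastforce simp: step)
qed

lemma effective_rev:
  assumes "effective ea (list_code ex) xs" shows "effective ea (list_code ex) (\<lambda>a. rev (xs a))"
proof -
  have "effective (pair_code ea (pair_code ex (list_code ex))) (list_code ex)
      (\<lambda>t. fst (snd t) # snd (snd t))"
    by (rule effective_Cons effective_proj)+
  then have "effective ea (list_code ex) (\<lambda>a. fold Cons (xs a) [])"
    by (rule effective_fold[where f = "\<lambda>_. Cons", OF _ assms effective_const])
  then show ?thesis by (simp add: fold_Cons_rev)
qed

lemma effective_foldr:
  assumes "effective (pair_code ea (pair_code ex es)) es (\<lambda>t. f (fst t) (fst (snd t)) (snd (snd t)))"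
    and "effective ea (list_code ex) xs" "effective ea es s"
  shows "effective ea es (\<lambda>a. foldr (f a) (xs a) (s a))"
  unfolding foldr_conv_fold
  by (rule effective_fold[where f = f, OF assms(1) effective_rev[OF assms(2)] assms(3)])

lemma effective_append:
  assumes "effective ea (list_code ex) xs" "effective ea (list_code ex) ys"
  shows "effective ea (list_code ex) (\<lambda>a. xs a @ ys a)"
proof -
  have "effective (pair_code ea (pair_code ex (list_code ex))) (list_code ex)
      (\<lambda>t. fst (snd t) # snd (snd t))"
    by (rule effective_Cons effective_proj)+
  then have "effective ea (list_code ex) (\<lambda>a. foldr Cons (xs a) (ys a))"
    by (rule effective_foldr[where f = "\<lambda>_. Cons", OF _ assms])
  moreover have "foldr Cons us vs = us @ vs" for us vs :: "'b list" by (induction us) simp_all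
  ultimately show ?thesis by simp
qed

lemma effective_concat_map:
  assumes f: "effective (pair_code ea ex) (list_code ey) (\<lambda>t. f (fst t) (snd t))"
    and xs: "effective ea (list_code ex) xs"
  shows "effective ea (list_code ey) (\<lambda>a. concat (map (f a) (xs a)))"
proof -
  let ?e = "pair_code ea (pair_code ex (list_code ey))"
  have "effective ?e (pair_code ea ex) (\<lambda>t. (fst t, fst (snd t)))"
    by (intro effective_Pair effective_fst effective_comp[OF effective_fst effective_snd])
  from effective_comp[OF f this]
  have "effective ?e (list_code ey) (\<lambda>t. f (fst t) (fst (snd t)) @ snd (snd t))"
    by (intro effective_append effective_comp[OF effective_snd effective_snd]) simp
  then have "effective ea (list_code ey) (\<lambda>a. foldr (\<lambda>x. (@) (f a x)) (xs a) [])"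
    by (rule effective_foldr[where f = "\<lambda>a x. (@) (f a x)", OF _ xs effective_const])
  moreover have "foldr (\<lambda>x. (@) (h x)) us [] = concat (map h us)" for h :: "'b \<Rightarrow> 'c list" and us
    by (induction us) simp_all
  ultimately show ?thesis by simp
qed

lemma effective_map:
  assumes "effective (pair_code ea ex) ey (\<lambda>t. f (fst t) (snd t))"
    and "effective ea (list_code ex) xs"
  shows "effective ea (list_code ey) (\<lambda>a. map (f a) (xs a))"
proof -
  have "effective ea (list_code ey) (\<lambda>a. concat (map (\<lambda>x. [f a x]) (xs a)))"
    by (rule effective_concat_map[where f = "\<lambda>a x. [f a x]",
          OF effective_Cons[OF assms(1) effective_const] assms(2)])
  then show ?thesis by (simp add: concat_map_singleton)
qed

section \<open>Translates of finite sets and boxes in groups\<close>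

text \<open>The symbol \<open><#\<close> stands for left cosets below, not for multiset inclusion.\<close>

no_notation subset_mset (infix "<#" 50)

text \<open>A box need not have unique exponents. Thus it makes sense for any list of elements, and it can
  be listed without knowledge of the relations between them.\<close>

definition segment :: "('a, 'b) monoid_scheme \<Rightarrow> 'a \<Rightarrow> nat \<Rightarrow> 'a set" where
  "segment G y b = (\<lambda>e. y [^]\<^bsub>G\<^esub> e) ` {..<b}"

primrec box :: "('a, 'b) monoid_scheme \<Rightarrow> ('a \<times> nat) list \<Rightarrow> 'a set" where
  "box G [] = {\<one>\<^bsub>G\<^esub>}"
| "box G (yb # ys) = segment G (fst yb) (snd yb) <#>\<^bsub>G\<^esub> box G ys"

lemma box_consistent: "box (subgroup_of G H) ys = box G ys"
  by (induction ys) (simp_all add: segment_def nat_pow_def)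

lemma set_mult_image: "S <#>\<^bsub>G\<^esub> K = (\<lambda>(s, k). s \<otimes>\<^bsub>G\<^esub> k) ` (S \<times> K)"
  by (auto simp: set_mult_def)

lemma l_coset_image: "x <#\<^bsub>G\<^esub> F = (\<lambda>y. x \<otimes>\<^bsub>G\<^esub> y) ` F"
  by (auto simp: l_coset_def)

lemma l_cosetI: "y \<in> F \<Longrightarrow> x \<otimes>\<^bsub>G\<^esub> y \<in> x <#\<^bsub>G\<^esub> F"
  by (auto simp: l_coset_def)

lemma finite_box: "finite (box G ys)"
  by (induction ys) (simp_all add: segment_def set_mult_image)

text \<open>The boundary of \<open>F n\<close> under translation by \<open>g\<close> has relative size \<open>O(1/n)\<close>. A constant that
  depends on \<open>g\<close> makes the elements with this property a subgroup.\<close>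

definition nearly_invariant :: "('a, 'b) monoid_scheme \<Rightarrow> (nat \<Rightarrow> 'a set) \<Rightarrow> 'a \<Rightarrow> bool" where
  "nearly_invariant G F g \<longleftrightarrow>
    (\<exists>C. \<forall>n>0. n * card (F n - (g <#\<^bsub>G\<^esub> F n)) \<le> C * card (F n))"

context group
begin

lemma segment_subgroup:
  assumes "subgroup A G" "y \<in> A" shows "segment G y b \<subseteq> A"
proof -
  have "y [^] (e::nat) \<in> A" for e
    by (induction e) (simp_all add: assms subgroup.one_closed subgroup.m_closed)
  then show ?thesis by (auto simp: segment_def)
qed

lemma box_subgroup:
  assumes A: "subgroup A G" shows "fst ` set ys \<subseteq> A \<Longrightarrow> box G ys \<subseteq> A"
proof (induction ys)
  case (Cons y ys)
  then show ?case
    using segment_subgroup[OF A] subgroup.m_closed[OF A] by (fastforce simp: set_mult_def)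
qed (simp add: subgroup.one_closed[OF A])

lemma box_closed: "fst ` set ys \<subseteq> carrier G \<Longrightarrow> box G ys \<subseteq> carrier G"
  by (rule box_subgroup[OF subgroup_self])

lemma box_nonempty: "(\<And>yb. yb \<in> set ys \<Longrightarrow> 0 < snd yb) \<Longrightarrow> box G ys \<noteq> {}"
  by (induction ys) (fastforce simp: segment_def set_mult_image)+

lemma card_l_coset:
  assumes "F \<subseteq> carrier G" "x \<in> carrier G" shows "card (x <# F) = card F"
  unfolding l_coset_image
  by (rule card_image) (meson assms inj_on_cmult inj_on_subset)

lemma l_coset_diff:
  assumes "F \<subseteq> carrier G" "F' \<subseteq> carrier G" "x \<in> carrier G"
  shows "x <# (F - F') = (x <# F) - (x <# F')"
  unfolding l_coset_image
  by (rule inj_on_image_set_diff[of _ "carrier G"]) (use assms inj_on_cmult in auto)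

lemma card_translate_diff_mult:
  assumes F: "finite F" "F \<subseteq> carrier G" and g: "g \<in> carrier G" and h: "h \<in> carrier G"
  shows "card (F - ((g \<otimes> h) <# F)) \<le> card (F - (g <# F)) + card (F - (h <# F))"
proof -
  have sub: "h <# F \<subseteq> carrier G" using F h by (simp add: l_coset_subset_G)
  have "F - ((g \<otimes> h) <# F) \<subseteq> (F - (g <# F)) \<union> (g <# (F - (h <# F)))"
    using F g h sub by (auto simp: l_coset_diff lcos_m_assoc)
  moreover have "finite (g <# (F - (h <# F)))" using F by (simp add: l_coset_image)
  ultimately have "card (F - ((g \<otimes> h) <# F)) \<le> card ((F - (g <# F)) \<union> (g <# (F - (h <# F))))"
    using F by (intro card_mono) auto
  also have "\<dots> \<le> card (F - (g <# F)) + card (g <# (F - (h <# F)))" by (rule card_Un_le)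
  also have "card (g <# (F - (h <# F))) = card (F - (h <# F))"
    using F g by (intro card_l_coset) auto
  finally show ?thesis by simp
qed

lemma card_translate_diff_inv:
  assumes F: "finite F" "F \<subseteq> carrier G" and g: "g \<in> carrier G"
  shows "card (F - (inv g <# F)) = card (F - (g <# F))"
proof -
  have sub: "inv g <# F \<subseteq> carrier G" "g <# F \<subseteq> carrier G" using F g by (simp_all add: l_coset_subset_G)
  have fin: "finite (g <# F)" using F by (simp add: l_coset_image)
  have "card (F - (inv g <# F)) = card (g <# (F - (inv g <# F)))"
    using F g by (intro card_l_coset[symmetric]) auto
  also have "g <# (F - (inv g <# F)) = (g <# F) - F"
    using F g sub by (simp add: l_coset_diff lcos_m_assoc lcos_mult_one)
  also have "card ((g <# F) - F) = card (F - (g <# F))"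
    using F fin card_l_coset[OF F(2) g] by (simp add: card_Diff_subset_Int Int_commute)
  finally show ?thesis .
qed

lemma nearly_invariant_generate:
  assumes F: "\<And>n. finite (F n)" "\<And>n. F n \<subseteq> carrier G" and X: "X \<subseteq> carrier G"
    and inv: "\<And>x. x \<in> X \<Longrightarrow> nearly_invariant G F x"
  shows "g \<in> generate G X \<Longrightarrow> nearly_invariant G F g"
proof (induction rule: generate.induct)
  case one
  show ?case using F by (auto simp: nearly_invariant_def lcos_mult_one)
next
  case (incl h)
  then show ?case by (rule inv)
next
  case (inv h)
  then have "h \<in> carrier G" using X by auto
  then show ?case
    using assms(4)[OF inv] F by (simp add: nearly_invariant_def card_translate_diff_inv)
next
  case (eng g h)
  then obtain C D where C: "\<And>n. n > 0 \<Longrightarrow> n * card (F n - (g <# F n)) \<le> C * card (F n)"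
    and D: "\<And>n. n > 0 \<Longrightarrow> n * card (F n - (h <# F n)) \<le> D * card (F n)"
    unfolding nearly_invariant_def by blast
  have le: "card (F n - ((g \<otimes> h) <# F n)) \<le> card (F n - (g <# F n)) + card (F n - (h <# F n))" for n
    using eng(1,2) generate_in_carrier[OF X] F by (intro card_translate_diff_mult) auto
  have "n * card (F n - ((g \<otimes> h) <# F n)) \<le> (C + D) * card (F n)" if "n > 0" for n
  proof -
    have "n * card (F n - ((g \<otimes> h) <# F n)) \<le> n * card (F n - (g <# F n)) + n * card (F n - (h <# F n))"
      using le by (simp add: distrib_left[symmetric])
    also have "\<dots> \<le> C * card (F n) + D * card (F n)" using C D that by (intro add_mono) auto
    finally show ?thesis by (simp add: distrib_right)
  qed
  then show ?case unfolding nearly_invariant_def by blast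
qed

text \<open>The powers of \<open>x\<close> in question lie in pairwise different cosets of \<open>A\<close>.\<close>

lemma inj_on_segment_set_mult:
  assumes A: "subgroup A G" and x: "x \<in> carrier G" and S: "S \<subseteq> A"
    and free: "\<And>e. 0 < e \<Longrightarrow> e < b \<Longrightarrow> x [^] e \<notin> A"
  shows "inj_on (\<lambda>(e::nat, s). x [^] e \<otimes> s) ({..<b} \<times> S)"
proof -
  have le: "e = e'" if "e < b" "e' < b" "s \<in> S" "s' \<in> S" "x [^] e \<otimes> s = x [^] e' \<otimes> s'" "e \<le> e'"
    for e e' :: nat and s s'
  proof (rule ccontr)
    assume "e \<noteq> e'"
    have s: "s \<in> A" "s' \<in> A" "s \<in> carrier G" "s' \<in> carrier G"
      using that S subgroup.subset[OF A] by auto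
    have "x [^] e' = x [^] e \<otimes> x [^] (e' - e)" using x that(6) by (simp add: nat_pow_mult)
    then have "x [^] e \<otimes> s = x [^] e \<otimes> (x [^] (e' - e) \<otimes> s')"
      using that(5) x s by (simp add: m_assoc)
    then have "s = x [^] (e' - e) \<otimes> s'" using x s by simp
    then have "x [^] (e' - e) = s \<otimes> inv s'" using x s by (simp add: m_assoc)
    then have "x [^] (e' - e) \<in> A" using s A by (simp add: subgroup.m_closed subgroup.m_inv_closed)
    moreover have "0 < e' - e" "e' - e < b" using that \<open>e \<noteq> e'\<close> by auto
    ultimately show False using free by blast
  qed
  have "e = e' \<and> s = s'" if "e < b" "e' < b" "s \<in> S" "s' \<in> S" "x [^] e \<otimes> s = x [^] e' \<otimes> s'"
    for e e' :: nat and s s'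
  proof -
    have "e = e'" using le[OF that] le[OF that(2,1,4,3) that(5)[symmetric]] by linarith
    moreover have "s \<in> carrier G" "s' \<in> carrier G" using that S subgroup.subset[OF A] by auto
    ultimately show ?thesis using that x by auto
  qed
  then show ?thesis by (auto simp: inj_on_def)
qed

end

text \<open>The value \<open>d = 0\<close> encodes infinite relative order, following the convention for the order of
  an element.\<close>

definition bound :: "nat \<Rightarrow> nat \<Rightarrow> nat" where
  "bound n d = (if d = 0 then n else d)"

text \<open>Induction on the list of generators. Let \<open>A\<close> be generated by the later ones, with boxes \<open>F\<close>, and
  let \<open>d\<close> be the order of \<open>x\<close> modulo \<open>A\<close>. The new box \<open>F'\<close> is a disjoint union of translates of \<open>F\<close> by
  powers of \<open>x\<close>, so elements of \<open>A\<close> move the same proportion of it as before. Translation by \<open>x\<close> shifts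
  these layers by one, and only points of the bottom layer \<open>F\<close> can be lost. If the order is infinite,
  this layer is one of \<open>n\<close>. If it is finite, the top layer is sent to \<open>x^d \<otimes> F\<close>, which agrees with \<open>F\<close> up
  to a proportion \<open>O(1/n)\<close> as \<open>x^d \<in> A\<close>.\<close>

lemma (in comm_group) abelian_Folner_boxes:
  assumes "set xs \<subseteq> carrier G"
  shows "\<exists>ds. length ds = length xs \<and>
    (\<forall>g\<in>generate G (set xs). nearly_invariant G (\<lambda>n. box G (zip xs (map (bound n) ds))) g)"
  using assms
proof (induction xs)
  case Nil
  have "nearly_invariant G (\<lambda>n. {\<one>}) \<one>" by (simp add: nearly_invariant_def lcos_mult_one)
  then show ?case by (simp add: generate_empty)
next
  case (Cons x xs)
  then have x: "x \<in> carrier G" and xs: "set xs \<subseteq> carrier G" by auto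
  define A where "A = generate G (set xs)"
  have A: "subgroup A G" unfolding A_def using xs by (rule generate_is_subgroup)
  obtain ds where ds: "length ds = length xs"
    and IH: "\<And>g. g \<in> A \<Longrightarrow> nearly_invariant G (\<lambda>n. box G (zip xs (map (bound n) ds))) g"
    using Cons.IH xs unfolding A_def by blast
  define F where "F n = box G (zip xs (map (bound n) ds))" for n
  have FA: "F n \<subseteq> A" for n
    unfolding F_def by (intro box_subgroup[OF A]) (auto simp: A_def dest!: set_zip_leftD intro: generate.incl)
  have F: "F n \<subseteq> carrier G" "finite (F n)" for n
    using FA[of n] subgroup.subset[OF A] by (auto simp: F_def finite_box)
  have FC: "s \<in> carrier G" if "s \<in> F n" for s n using that F(1) by blast
  obtain d where d_pow: "0 < d \<Longrightarrow> x [^] d \<in> A"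
    and free: "\<And>e n. 0 < e \<Longrightarrow> e < bound n d \<Longrightarrow> x [^] e \<notin> A"
  proof (cases "\<exists>e::nat>0. x [^] e \<in> A")
    case True
    define d where "d = (LEAST e::nat. 0 < e \<and> x [^] e \<in> A)"
    have "0 < d \<and> x [^] d \<in> A" unfolding d_def using True by (rule LeastI_ex)
    moreover have "x [^] e \<notin> A" if "0 < e" "e < d" for e
      using that not_less_Least unfolding d_def by blast
    ultimately show ?thesis by (intro that[of d]) (simp_all add: bound_def)
  next
    case False
    then have "x [^] e \<notin> A" if "0 < e" for e :: nat using that by blast
    then show ?thesis by (intro that[of 0]) simp_all
  qed
  define F' where "F' n = segment G x (bound n d) <#> F n" for n
  have F': "F' n = (\<lambda>(e::nat, s). x [^] e \<otimes> s) ` ({..<bound n d} \<times> F n)" for n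
    by (auto simp: F'_def segment_def set_mult_def)
  have F'I: "x [^] e \<otimes> s \<in> F' n" if "e < bound n d" "s \<in> F n" for e s n
    using that by (force simp: F')
  have F'_carrier: "finite (F' n)" "F' n \<subseteq> carrier G" for n
    using F[of n] x by (auto simp: F')
  have card_F': "card (F' n) = bound n d * card (F n)" for n
  proof -
    have "inj_on (\<lambda>(e::nat, s). x [^] e \<otimes> s) ({..<bound n d} \<times> F n)"
      by (rule inj_on_segment_set_mult[OF A x FA free])
    then show ?thesis by (simp add: F' card_image card_cartesian_product)
  qed
  \<comment> \<open>Translation by elements of \<open>A\<close> preserves each layer of \<open>F'\<close>.\<close>
  have old: "nearly_invariant G F' g" if g: "g \<in> set xs" for g
  proof -
    have gA: "g \<in> A" using g generate.incl unfolding A_def by metis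
    then have gc: "g \<in> carrier G" using subgroup.subset[OF A] by blast
    obtain C where C: "n * card (F n - (g <# F n)) \<le> C * card (F n)" if "n > 0" for n
      using IH[OF gA] unfolding nearly_invariant_def F_def by blast
    have "n * card (F' n - (g <# F' n)) \<le> C * card (F' n)" if "n > 0" for n
    proof -
      let ?B = "{..<bound n d} \<times> (F n - (g <# F n))"
      have "F' n - (g <# F' n) \<subseteq> (\<lambda>(e::nat, s). x [^] e \<otimes> s) ` ?B"
      proof
        fix y assume y: "y \<in> F' n - (g <# F' n)"
        then obtain e s where es: "e < bound n d" "s \<in> F n" "y = x [^] e \<otimes> s" by (auto simp: F')
        have "s \<notin> g <# F n"
        proof
          assume "s \<in> g <# F n"
          then obtain t where t: "t \<in> F n" "s = g \<otimes> t" by (auto simp: l_coset_image)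
          then have "y = g \<otimes> (x [^] e \<otimes> t)" using es x gc FC[OF t(1)] by (simp add: m_lcomm)
          then have "y \<in> g <# F' n" using F'I[OF es(1) t(1)] by (simp add: l_cosetI)
          with y show False by blast
        qed
        with es show "y \<in> (\<lambda>(e::nat, s). x [^] e \<otimes> s) ` ?B" by force
      qed
      then have "card (F' n - (g <# F' n)) \<le> card ((\<lambda>(e::nat, s). x [^] e \<otimes> s) ` ?B)"
        using F by (intro card_mono) auto
      also have "\<dots> \<le> card ?B" using F by (intro card_image_le) auto
      also have "\<dots> = bound n d * card (F n - (g <# F n))" by (simp add: card_cartesian_product)
      finally have "n * card (F' n - (g <# F' n)) \<le> bound n d * (n * card (F n - (g <# F n)))"
        by (metis mult.left_commute mult_le_mono2)
      also have "\<dots> \<le> bound n d * (C * card (F n))" using C[OF that] by (rule mult_le_mono2)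
      finally show ?thesis by (simp add: card_F' mult_ac)
    qed
    then show ?thesis unfolding nearly_invariant_def by blast
  qed
  \<comment> \<open>A point of a layer above the bottom is the translate of a point of the layer below it.\<close>
  have zero: "F' n - (x <# F' n) \<subseteq> F n" for n
  proof
    fix y assume y: "y \<in> F' n - (x <# F' n)"
    then obtain e s where es: "e < bound n d" "s \<in> F n" "y = x [^] e \<otimes> s" by (auto simp: F')
    show "y \<in> F n"
    proof (cases e)
      case 0
      then show ?thesis using es FC by simp
    next
      case (Suc k)
      then have "y = x \<otimes> (x [^] k \<otimes> s)"
        using es x FC[OF es(2)] by (simp add: m_ac)
      then have "y \<in> x <# F' n" using F'I[of k n s] es Suc by (simp add: l_cosetI)
      with y show ?thesis by blast
    qed
  qed
  have new: "nearly_invariant G F' x"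
  proof (cases "d = 0")
    case True
    have "n * card (F' n - (x <# F' n)) \<le> 1 * card (F' n)" for n
      using card_mono[OF F(2) zero[of n]] True by (simp add: card_F' bound_def)
    then show ?thesis unfolding nearly_invariant_def by blast
  next
    case False
    define h where "h = x [^] d"
    have hA: "h \<in> A" using d_pow False by (simp add: h_def)
    obtain C where C: "n * card (F n - (h <# F n)) \<le> C * card (F n)" if "n > 0" for n
      using IH[OF hA] unfolding nearly_invariant_def F_def by blast
    have "F' n - (x <# F' n) \<subseteq> F n - (h <# F n)" for n
    proof -
      have "h \<otimes> t \<in> x <# F' n" if t: "t \<in> F n" for t
      proof -
        obtain k where k: "d = Suc k" using False by (cases d) auto
        have "h \<otimes> t = x \<otimes> (x [^] k \<otimes> t)"
          using x FC[OF t] unfolding h_def k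
          by (simp add: m_ac)
        then show ?thesis using F'I[of k n t] t k by (simp add: l_cosetI bound_def)
      qed
      then have "h <# F n \<subseteq> x <# F' n" by (auto simp: l_coset_image)
      then show ?thesis using zero[of n] by blast
    qed
    then have "card (F' n - (x <# F' n)) \<le> card (F n - (h <# F n))" for n
      using F(2) by (intro card_mono) auto
    moreover have "card (F n) \<le> card (F' n)" for n using False by (simp add: card_F' bound_def)
    ultimately have "n * card (F' n - (x <# F' n)) \<le> C * card (F' n)" if "n > 0" for n
      using C[OF that] by (meson mult_le_mono2 order_trans)
    then show ?thesis unfolding nearly_invariant_def by blast
  qed
  have "nearly_invariant G F' g" if "g \<in> generate G (set (x # xs))" for g
    using Cons.prems old new by (intro nearly_invariant_generate[OF F'_carrier _ _ that]) auto
  moreover have "F' = (\<lambda>n. box G (zip (x # xs) (map (bound n) (d # ds))))"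
    by (simp add: fun_eq_iff F'_def F_def)
  ultimately show ?case
    using ds by (intro exI[of _ "d # ds"]) simp
qed

text \<open>Multiplication by a generator raises its exponent by one modulo \<open>p\<close>. Together with finiteness
  this is all that is needed from the subgroup generated by \<open>ys\<close>, and it is true even if exponents are
  not unique.\<close>

lemma (in comm_group) translate_torsion_box:
  assumes "set ys \<subseteq> carrier G" "\<And>y. y \<in> set ys \<Longrightarrow> y [^] p = \<one>" "y \<in> set ys" "0 < p"
  shows "y <# box G (map (\<lambda>y. (y, p)) ys) \<subseteq> box G (map (\<lambda>y. (y, p)) ys)"
  using assms
proof (induction ys)
  case (Cons z ys)
  let ?B = "box G (map (\<lambda>y. (y, p)) ys)"
  have B: "?B \<subseteq> carrier G" using Cons.prems by (intro box_closed) auto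
  have z: "z \<in> carrier G" "y \<in> carrier G" using Cons.prems by auto
  show ?case
  proof
    fix g assume "g \<in> y <# box G (map (\<lambda>y. (y, p)) (z # ys))"
    then obtain e b where e: "e < p" and b: "b \<in> ?B" and g: "g = y \<otimes> (z [^] e \<otimes> b)"
      by (auto simp: l_coset_image set_mult_def segment_def)
    have bc: "b \<in> carrier G" using b B by auto
    consider "y = z" | "y \<in> set ys" using Cons.prems by auto
    then have "\<exists>e' < p. \<exists>b' \<in> ?B. g = z [^] e' \<otimes> b'"
    proof cases
      case 1
      have "z \<otimes> z [^] e = z [^] Suc e" using z by (simp only: nat_pow_Suc2)
      also have "\<dots> = z [^] (if Suc e < p then Suc e else 0)"
        using e Cons.prems(2)[of z] by (cases "Suc e < p") (auto simp: not_less le_antisym simp del: nat_pow_Suc dest!: le_antisym)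
      finally have "g = z [^] (if Suc e < p then Suc e else 0) \<otimes> b"
        using g 1 z bc by (simp add: m_assoc[symmetric] del: nat_pow_Suc)
      then show ?thesis using b e by (intro exI[of _ "if Suc e < p then Suc e else 0"]) auto
    next
      case 2
      then have "y \<otimes> b \<in> ?B" using Cons b by (auto simp: l_coset_image)
      moreover have "g = z [^] e \<otimes> (y \<otimes> b)" using g z bc by (simp add: m_lcomm)
      ultimately show ?thesis using e by blast
    qed
    then show "g \<in> box G (map (\<lambda>y. (y, p)) (z # ys))"
      by (auto simp: set_mult_def segment_def)
  qed
qed simp

context group
begin

lemma card_translate_diff_set_mult:
  assumes S: "finite S" "S \<subseteq> carrier G" and K: "finite K" "K \<subseteq> carrier G"
    and inj: "inj_on (\<lambda>(s, k). s \<otimes> k) (S \<times> K)" and x: "x \<in> carrier G"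
  shows "card ((S <#> K) - (x <# (S <#> K))) \<le> card (S - (x <# S)) * card K"
    and "card (S <#> K) = card S * card K"
proof -
  have "(S <#> K) - (x <# (S <#> K)) \<subseteq> (S - (x <# S)) <#> K"
    using setmult_lcos_assoc[OF S(2) K(2) x] by (auto simp: set_mult_def)
  then have "card ((S <#> K) - (x <# (S <#> K))) \<le> card ((S - (x <# S)) <#> K)"
    using S K by (intro card_mono) (auto simp: set_mult_image)
  also have "\<dots> \<le> card ((S - (x <# S)) \<times> K)"
    unfolding set_mult_image using S K by (intro card_image_le) auto
  finally show "card ((S <#> K) - (x <# (S <#> K))) \<le> card (S - (x <# S)) * card K"
    by (simp add: card_cartesian_product)
  show "card (S <#> K) = card S * card K"
    unfolding set_mult_image using inj by (simp add: card_image card_cartesian_product)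
qed

lemma inj_on_complement_mult:
  assumes A: "subgroup A G" and B: "subgroup B G" and "A \<inter> B = {\<one>}"
  shows "inj_on (\<lambda>(a, b). a \<otimes> b) (A \<times> B)"
proof -
  have "a = a' \<and> b = b'" if "a \<in> A" "a' \<in> A" "b \<in> B" "b' \<in> B" "a \<otimes> b = a' \<otimes> b'" for a a' b b'
  proof -
    have c: "a \<in> carrier G" "a' \<in> carrier G" "b \<in> carrier G" "b' \<in> carrier G"
      using that subgroup.subset[OF A] subgroup.subset[OF B] by auto
    have "inv a' \<otimes> a = b' \<otimes> inv b"
      using that(5) c by (metis inv_closed inv_solve_left inv_solve_right m_assoc m_closed)
    then have "inv a' \<otimes> a \<in> A \<inter> B"
      using that A B by (metis IntI subgroup.m_closed subgroup.m_inv_closed)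
    then have "inv a' \<otimes> a = \<one>" using assms(3) by blast
    then have "a = a'" using c by (metis inv_comm inv_equality inv_inv inv_closed)
    then show ?thesis using that c by auto
  qed
  then show ?thesis by (auto simp: inj_on_def)
qed

lemma translate_eq_self:
  assumes "finite F" "F \<subseteq> carrier G" "x \<in> carrier G" "x <# F \<subseteq> F"
  shows "x <# F = F"
  using assms card_l_coset[of F x] by (intro card_subset_eq) auto

text \<open>The reason is that \<open>x \<otimes> s \<otimes> k = s \<otimes> (inv s \<otimes> x \<otimes> s) \<otimes> k\<close>.\<close>

lemma translate_conjugates:
  assumes S: "S \<subseteq> carrier G" and K: "K \<subseteq> carrier G" and x: "x \<in> carrier G"
    and conj: "\<And>s. s \<in> S \<Longrightarrow> (inv s \<otimes> x \<otimes> s) <# K \<subseteq> K"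
  shows "x <# (S <#> K) \<subseteq> S <#> K"
proof
  fix g assume "g \<in> x <# (S <#> K)"
  then obtain s k where s: "s \<in> S" and k: "k \<in> K" and g: "g = x \<otimes> (s \<otimes> k)"
    by (auto simp: l_coset_image set_mult_def)
  have c: "s \<in> carrier G" "k \<in> carrier G" using s k S K by auto
  have "g = s \<otimes> (inv s \<otimes> x \<otimes> s \<otimes> k)"
    using g c x by (simp add: m_assoc[symmetric])
  moreover have "inv s \<otimes> x \<otimes> s \<otimes> k \<in> K" using conj[OF s] k by (auto simp: l_coset_image)
  ultimately show "g \<in> S <#> K" using s by (auto simp: set_mult_def)
qed

end

section \<open>Algorithms on lists of words\<close>

definition word_inverse :: "'x word \<Rightarrow> 'x word" where
  "word_inverse w = rev (map inv_letter w)"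

definition products :: "'x word list \<Rightarrow> 'x word list \<Rightarrow> 'x word list" where
  "products A B = concat (map (\<lambda>u. map (\<lambda>v. u @ v) B) A)"

definition powers :: "'x word \<Rightarrow> nat \<Rightarrow> 'x word list" where
  "powers w b = ((\<lambda>P. [] # map (\<lambda>u. w @ u) P) ^^ b) []"

definition word_box :: "('x word \<times> nat) list \<Rightarrow> 'x word list" where
  "word_box ys = foldr (\<lambda>y. products (powers (fst y) (snd y))) ys [[]]"

definition conjugates :: "'x word list \<Rightarrow> 'x word list \<Rightarrow> 'x word list" where
  "conjugates xs W = concat (map (\<lambda>x. map (\<lambda>w. word_inverse w @ x @ w) W) xs)"

definition torsion_words :: "nat \<Rightarrow> 'x word list \<Rightarrow> 'x word list" where
  "torsion_words p ys = word_box (map (\<lambda>y. (y, p)) ys)"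

definition letter_code :: "'x set \<Rightarrow> 'x \<times> bool \<Rightarrow> nat" where
  "letter_code X a = 2 * to_nat_on X (fst a) + of_bool (snd a)"

lemma word_list_code_list_code: "word_list_code X = list_code (list_code (letter_code X))"
proof
  fix ws
  have "word_code X = list_code (letter_code X)"
    by (simp add: fun_eq_iff word_code_def list_code_def letter_code_def[abs_def])
  then show "word_list_code X ws = list_code (list_code (letter_code X)) ws"
    by (simp add: word_list_code_def list_code_def)
qed

lemma effective_products:
  assumes "effective ea (list_code (list_code e)) A" "effective ea (list_code (list_code e)) B"
  shows "effective ea (list_code (list_code e)) (\<lambda>a. products (A a) (B a))"
proof -
  have "effective (pair_code (pair_code ea (list_code e)) (list_code e)) (list_code e)
      (\<lambda>s. snd (fst s) @ snd s)"
    by (rule effective_append effective_proj)+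
  then have "effective (pair_code ea (list_code e)) (list_code (list_code e))
      (\<lambda>t. map (\<lambda>v. snd t @ v) (B (fst t)))"
    by (rule effective_map[where f = "\<lambda>t v. snd t @ v", OF _ effective_weaken[OF assms(2)]])
  then show ?thesis unfolding products_def
    by (rule effective_concat_map[where f = "\<lambda>a u. map (\<lambda>v. u @ v) (B a)", OF _ assms(1)])
qed

lemma effective_powers:
  assumes "effective ea (list_code e) w" "effective ea (\<lambda>n. n) b"
  shows "effective ea (list_code (list_code e)) (\<lambda>a. powers (w a) (b a))"
proof -
  let ?e = "pair_code ea (list_code (list_code e))"
  have "effective (pair_code ?e (list_code e)) (list_code e) (\<lambda>s. w (fst (fst s)) @ snd s)"
    by (rule effective_append[OF effective_weaken[OF effective_weaken[OF assms(1)]] effective_snd])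
  then have "effective ?e (list_code (list_code e)) (\<lambda>t. map (\<lambda>u. w (fst t) @ u) (snd t))"
    by (rule effective_map[where f = "\<lambda>t u. w (fst t) @ u", OF _ effective_snd])
  then have "effective ?e (list_code (list_code e)) (\<lambda>t. [] # map (\<lambda>u. w (fst t) @ u) (snd t))"
    by (rule effective_Cons[OF effective_const])
  then show ?thesis unfolding powers_def
    by (rule effective_funpow[where f = "\<lambda>a P. [] # map (\<lambda>u. w a @ u) P", OF _ assms(2) effective_const])
qed

lemma effective_word_box:
  assumes "effective ea (list_code (pair_code (list_code e) (\<lambda>n. n))) ys"
  shows "effective ea (list_code (list_code e)) (\<lambda>a. word_box (ys a))"
  unfolding word_box_def
  by (rule effective_foldr[where f = "\<lambda>_ y. products (powers (fst y) (snd y))",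
        OF _ assms effective_const])
    (rule effective_products effective_powers effective_proj)+

lemma effective_torsion_words:
  assumes "effective ea (list_code (list_code e)) ys"
  shows "effective ea (list_code (list_code e)) (\<lambda>a. torsion_words p (ys a))"
  unfolding torsion_words_def
  by (rule effective_word_box effective_map[where f = "\<lambda>_ y. (y, p)"] effective_Pair
      effective_snd effective_const assms)+

lemma effective_word_inverse:
  assumes "effective e e inv_letter" "effective ea (list_code e) w"
  shows "effective ea (list_code e) (\<lambda>a. word_inverse (w a))"
  unfolding word_inverse_def
  by (rule effective_rev effective_map[where f = "\<lambda>_. inv_letter"]
      effective_comp[OF assms(1) effective_snd] assms(2))+

lemma effective_conjugates:
  assumes inv: "effective e e inv_letter"
    and xs: "effective ea (list_code (list_code e)) xs" and W: "effective ea (list_code (list_code e)) W"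
  shows "effective ea (list_code (list_code e)) (\<lambda>a. conjugates (xs a) (W a))"
proof -
  have "effective (pair_code (pair_code ea (list_code e)) (list_code e)) (list_code e)
      (\<lambda>s. word_inverse (snd s) @ snd (fst s) @ snd s)"
    by (rule effective_append effective_word_inverse[OF inv] effective_proj)+
  then have "effective (pair_code ea (list_code e)) (list_code (list_code e))
      (\<lambda>t. map (\<lambda>w. word_inverse w @ snd t @ w) (W (fst t)))"
    by (rule effective_map[where f = "\<lambda>t w. word_inverse w @ snd t @ w", OF _ effective_weaken[OF W]])
  then show ?thesis unfolding conjugates_def
    by (rule effective_concat_map[where f = "\<lambda>a x. map (\<lambda>w. word_inverse w @ x @ w) (W a)", OF _ xs])
qed

text \<open>Inversion of a letter exchanges the codes \<open>2 * i\<close> and \<open>2 * i + 1\<close>. Iterating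
  \<open>(a, b) \<mapsto> (b, a + 2)\<close> from \<open>(1, 0)\<close> produces the values \<open>1, 0, 3, 2, 5, 4, \<dots>\<close> of this exchange.\<close>

lemma effective_inv_letter: "effective (letter_code X) (letter_code X) inv_letter"
proof -
  let ?id = "\<lambda>n::nat. n"
  define flip where "flip n = (if even n then Suc n else n - 1)" for n :: nat
  define f where "f t = (snd t, Suc (Suc (fst t)))" for t :: "nat \<times> nat"
  have "(f ^^ n) (1, 0) = (flip n, flip (Suc n))" for n
    by (induction n) (auto simp: f_def flip_def elim: oddE)
  moreover have "effective ?id ?id (\<lambda>n. fst ((f ^^ n) (1, 0)))"
  proof -
    have "effective (pair_code ?id (pair_code ?id ?id)) (pair_code ?id ?id)
        (\<lambda>t. (snd (snd t), Suc (Suc (fst (snd t)))))"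
      by (rule effective_Pair effective_proj effective_comp[OF effective_computable[OF computable_Suc]])+
    then have "effective ?id (pair_code ?id ?id) (\<lambda>n. (f ^^ n) (1, 0))"
      unfolding f_def[abs_def]
      by (rule effective_funpow[where f = "\<lambda>_ t. (snd t, Suc (Suc (fst t)))",
            OF _ effective_id effective_const])
    then show ?thesis by (rule effective_comp[OF effective_fst])
  qed
  ultimately have "computable flip" using computable_effective by simp
  moreover have "flip (letter_code X a) = letter_code X (inv_letter a)" for a
    by (cases "snd a") (simp_all add: flip_def letter_code_def inv_letter_def)
  ultimately show ?thesis unfolding effective_def by blast
qed

text \<open>The lists \<open>ws\<close> and \<open>ds\<close> and the factor \<open>k\<close> are fixed; the argument of the algorithm enters only
  through the bounds.\<close>

lemma effective_zip_bounds:
  "effective (\<lambda>n. n) (list_code (pair_code ew (\<lambda>n. n)))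
    (\<lambda>n. zip ws (map (bound (k * n)) ds))"
proof (induction ws arbitrary: ds)
  case (Cons w ws)
  have "effective (\<lambda>n. n) (\<lambda>n. n) (\<lambda>n. bound (k * n) d)" for d
    by (rule effective_computable)
      (cases "d = 0", simp_all add: bound_def computable_mult_const computable_const)
  then show ?case
    by (cases ds) (simp_all add: effective_const effective_Cons effective_Pair Cons)
qed (simp add: effective_const)

context group
begin

lemma canonical_epi_generator: "x \<in> carrier G \<Longrightarrow> canonical_epi G [(x, True)] = x"
  by (simp add: canonical_epi_def letter_value_def)

context
  fixes X assumes X: "X \<subseteq> carrier G"
begin

lemma words_products: "set A \<subseteq> words X \<Longrightarrow> set B \<subseteq> words X \<Longrightarrow> set (products A B) \<subseteq> words X"
  by (auto simp: products_def)

lemma canonical_epi_products: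
  assumes "set A \<subseteq> words X" "set B \<subseteq> words X"
  shows "canonical_epi G ` set (products A B) = (canonical_epi G ` set A) <#> (canonical_epi G ` set B)"
proof -
  have "canonical_epi G (u @ v) = canonical_epi G u \<otimes> canonical_epi G v" if "u \<in> set A" "v \<in> set B" for u v
    using canonical_epi_append[OF X] that assms by blast
  then show ?thesis by (force simp: products_def set_mult_def)
qed

lemma canonical_epi_powers:
  assumes w: "w \<in> words X"
  shows "set (powers w b) \<subseteq> words X \<and> canonical_epi G ` set (powers w b) = segment G (canonical_epi G w) b"
proof (induction b)
  case 0
  show ?case by (simp add: powers_def segment_def)
next
  case (Suc b)
  let ?g = "canonical_epi G w"
  have g: "?g \<in> carrier G" using canonical_epi_closed[OF X w] .
  have step: "powers w (Suc b) = [] # map (\<lambda>u. w @ u) (powers w b)" by (simp add: powers_def)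
  have "canonical_epi G ` (\<lambda>u. w @ u) ` set (powers w b) = (\<lambda>h. ?g \<otimes> h) ` canonical_epi G ` set (powers w b)"
    unfolding image_image using canonical_epi_append[OF X w] Suc by (intro image_cong) auto
  also have "\<dots> = (\<lambda>e::nat. ?g [^] Suc e) ` {..<b}"
    using Suc nat_pow_Suc2[OF g] by (simp add: segment_def image_image del: nat_pow_Suc)
  finally have "canonical_epi G ` set (powers w (Suc b)) = insert \<one> ((\<lambda>e::nat. ?g [^] Suc e) ` {..<b})"
    unfolding step by (simp add: canonical_epi_def del: nat_pow_Suc)
  also have "\<dots> = segment G ?g (Suc b)"
    unfolding segment_def lessThan_Suc_eq_insert_0 by (simp add: image_image)
  finally show ?case using Suc w by (auto simp: step)
qed

lemma canonical_epi_word_box: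
  assumes "fst ` set ys \<subseteq> words X"
  shows "set (word_box ys) \<subseteq> words X \<and>
    canonical_epi G ` set (word_box ys) = box G (map (\<lambda>y. (canonical_epi G (fst y), snd y)) ys)"
  using assms
proof (induction ys)
  case Nil
  show ?case by (simp add: word_box_def canonical_epi_def)
next
  case (Cons y ys)
  have step: "word_box (y # ys) = products (powers (fst y) (snd y)) (word_box ys)"
    by (simp add: word_box_def)
  show ?case
    using Cons canonical_epi_powers[of "fst y" "snd y"]
    by (simp add: step words_products canonical_epi_products)
qed

lemma canonical_epi_torsion_words:
  assumes "set ys \<subseteq> words X"
  shows "set (torsion_words p ys) \<subseteq> words X"
    and "canonical_epi G ` set (torsion_words p ys) = box G (map (\<lambda>y. (y, p)) (map (canonical_epi G) ys))"
  using canonical_epi_word_box[of "map (\<lambda>y. (y, p)) ys"] assms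
  by (simp_all add: torsion_words_def image_image comp_def)

lemma canonical_epi_word_inverse:
  "w \<in> words X \<Longrightarrow> canonical_epi G (word_inverse w) = inv (canonical_epi G w)"
proof (induction w)
  case Nil
  show ?case by (simp add: word_inverse_def canonical_epi_def)
next
  case (Cons a w)
  then have a: "fst a \<in> X" and w: "w \<in> words X" by auto
  have "canonical_epi G (word_inverse (a # w)) = canonical_epi G (word_inverse w @ [inv_letter a])"
    by (simp add: word_inverse_def)
  also have "\<dots> = inv (canonical_epi G w) \<otimes> inv (letter_value G a)"
    using canonical_epi_append[OF X words_inverse[OF w], of "[inv_letter a]"] a Cons
      letter_value_inv_letter[OF X a] letter_value_closed[OF X a]
    by (simp add: word_inverse_def canonical_epi_def inv_letter_def)
  also have "\<dots> = inv (canonical_epi G (a # w))"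
    using letter_value_closed[OF X a] canonical_epi_closed[OF X w]
    by (simp add: canonical_epi_def inv_mult_group)
  finally show ?case .
qed

lemma canonical_epi_conjugates:
  assumes "set xs \<subseteq> words X" "set W \<subseteq> words X"
  shows "set (conjugates xs W) \<subseteq> words X"
    and "canonical_epi G ` set (conjugates xs W) =
      {inv s \<otimes> x \<otimes> s | x s. x \<in> canonical_epi G ` set xs \<and> s \<in> canonical_epi G ` set W}"
proof -
  have "canonical_epi G (word_inverse w @ x @ w) =
      inv (canonical_epi G w) \<otimes> canonical_epi G x \<otimes> canonical_epi G w"
    if "x \<in> set xs" "w \<in> set W" for x w
  proof -
    have xw: "x \<in> words X" "w \<in> words X" using that assms by auto
    have "word_inverse w \<in> words X" unfolding word_inverse_def by (rule words_inverse[OF xw(2)])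
    with xw show ?thesis
      using canonical_epi_closed[OF X]
      by (simp add: canonical_epi_append[OF X] canonical_epi_word_inverse m_assoc)
  qed
  then show "canonical_epi G ` set (conjugates xs W) =
      {inv s \<otimes> x \<otimes> s | x s. x \<in> canonical_epi G ` set xs \<and> s \<in> canonical_epi G ` set W}"
    by (force simp: conjugates_def)
  show "set (conjugates xs W) \<subseteq> words X"
    using assms words_inverse by (fastforce simp: conjugates_def word_inverse_def)
qed

end

section \<open>Folner sets of iterated semidirect products\<close>

lemma translate_torsion_box_subgroup:
  assumes N: "subgroup N G" "comm_group (subgroup_of G N)" "has_exponent (subgroup_of G N) p"
    and y: "set ys \<subseteq> N" "y \<in> set ys"
  shows "y <# box G (map (\<lambda>y. (y, p)) ys) \<subseteq> box G (map (\<lambda>y. (y, p)) ys)"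
proof -
  interpret N: comm_group "subgroup_of G N" by (rule N)
  have "y [^]\<^bsub>subgroup_of G N\<^esub> p = \<one>\<^bsub>subgroup_of G N\<^esub>" if "y \<in> set ys" for y
    using N(3) that y(1) by (auto simp: has_exponent_def)
  moreover have "0 < p" using N(3) by (simp add: has_exponent_def)
  ultimately have "y <#\<^bsub>subgroup_of G N\<^esub> box (subgroup_of G N) (map (\<lambda>y. (y, p)) ys)
      \<subseteq> box (subgroup_of G N) (map (\<lambda>y. (y, p)) ys)"
    using y by (intro N.translate_torsion_box) auto
  then show ?thesis by (simp add: box_consistent)
qed

text \<open>Replacing \<open>n\<close> by a common multiple of itself absorbs the constants of the finitely many
  generators.\<close>

lemma abelian_subgroup_Folner_boxes:
  assumes A: "subgroup A G" "comm_group (subgroup_of G A)" and xs: "set xs \<subseteq> A"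
  obtains ds k where "length ds = length xs" "0 < k"
    "\<And>x n. x \<in> set xs \<Longrightarrow> 0 < n \<Longrightarrow>
      n * card (box G (zip xs (map (bound (k * n)) ds)) - (x <# box G (zip xs (map (bound (k * n)) ds))))
        \<le> card (box G (zip xs (map (bound (k * n)) ds)))"
proof -
  interpret A: comm_group "subgroup_of G A" by (rule A)
  obtain ds where ds: "length ds = length xs"
    and inv: "\<And>g. g \<in> generate (subgroup_of G A) (set xs) \<Longrightarrow>
      nearly_invariant (subgroup_of G A) (\<lambda>n. box (subgroup_of G A) (zip xs (map (bound n) ds))) g"
    using A.abelian_Folner_boxes[of xs] xs by auto
  define F where "F n = box G (zip xs (map (bound n) ds))" for n
  have "\<exists>C. \<forall>n>0. n * card (F n - (x <# F n)) \<le> C * card (F n)" if "x \<in> set xs" for x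
    using inv[OF generate.incl[OF that]] by (simp add: nearly_invariant_def box_consistent F_def)
  then obtain C where C: "\<And>x n. x \<in> set xs \<Longrightarrow> 0 < n \<Longrightarrow> n * card (F n - (x <# F n)) \<le> C x * card (F n)"
    by metis
  define k where "k = Suc (\<Sum>x\<in>set xs. C x)"
  have k: "0 < k" by (simp add: k_def)
  have "n * card (F (k * n) - (x <# F (k * n))) \<le> card (F (k * n))" if "x \<in> set xs" "0 < n" for x n
  proof -
    have "C x \<le> (\<Sum>x\<in>set xs. C x)" using that(1) by (intro member_le_sum) auto
    then have Ck: "C x \<le> k" by (simp add: k_def)
    have "k * (n * card (F (k * n) - (x <# F (k * n)))) \<le> C x * card (F (k * n))"
      using C[OF that(1), of "k * n"] that(2) k by (simp add: mult.assoc)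
    also have "\<dots> \<le> k * card (F (k * n))" using Ck by simp
    finally show ?thesis using k by simp
  qed
  then show ?thesis using ds by (intro that[of ds k]) (auto simp: F_def k_def)
qed

text \<open>Generators in \<open>L0\<close> and \<open>L1\<close> permute the set, the latter through the first two factors already. For
  \<open>L2\<close>, the set is \<open>F2 <#> (F1 <#> F0)\<close> with unique factorisation, since \<open>F1 <#> F0\<close> lies in the complement
  \<open>B\<close> of \<open>A\<close>, and it is the blow-up of \<open>F2\<close> by the second factor.\<close>

lemma Folner_set_tower:
  assumes A: "subgroup A G" and B: "subgroup B G" and AB: "A \<inter> B = {\<one>}" and n: "1 \<le> n"
    and F2: "finite F2" "F2 \<noteq> {}" "F2 \<subseteq> A"
    and F1: "finite F1" "F1 \<noteq> {}" "F1 \<subseteq> B"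
    and F0: "finite F0" "F0 \<noteq> {}" "F0 \<subseteq> B"
    and L: "L0 \<union> L1 \<union> L2 \<subseteq> carrier G"
    and inv2: "\<And>x. x \<in> L2 \<Longrightarrow> n * card (F2 - (x <# F2)) \<le> card F2"
    and inv1: "\<And>x s. x \<in> L1 \<Longrightarrow> s \<in> F2 \<Longrightarrow> (inv s \<otimes> x \<otimes> s) <# F1 \<subseteq> F1"
    and inv0: "\<And>x s. x \<in> L0 \<Longrightarrow> s \<in> F2 <#> F1 \<Longrightarrow> (inv s \<otimes> x \<otimes> s) <# F0 \<subseteq> F0"
  shows "Folner_set G (L0 \<union> L1 \<union> L2) n ((F2 <#> F1) <#> F0)"
proof -
  let ?F = "(F2 <#> F1) <#> F0"
  have c: "F2 \<subseteq> carrier G" "F1 \<subseteq> carrier G" "F0 \<subseteq> carrier G"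
    using F2 F1 F0 subgroup.subset[OF A] subgroup.subset[OF B] by auto
  then have c21: "F2 <#> F1 \<subseteq> carrier G" and c10: "F1 <#> F0 \<subseteq> carrier G" and cF: "?F \<subseteq> carrier G"
    by (simp_all add: set_mult_closed)
  have fin: "finite (F1 <#> F0)" "finite ?F" using F2 F1 F0 by (simp_all add: set_mult_image)
  have ne: "?F \<noteq> {}" using F2 F1 F0 by (simp add: set_mult_image)
  have assoc: "?F = F2 <#> (F1 <#> F0)" using c by (simp add: set_mult_assoc)
  have "n * card (?F - (x <# ?F)) \<le> card ?F" if x_in: "x \<in> L0 \<union> L1 \<union> L2" for x
  proof -
    have x: "x \<in> carrier G" using x_in L by auto
    consider "x \<in> L0" | "x \<in> L1" | "x \<in> L2" using x_in by auto
    then show ?thesis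
    proof cases
      case 1
      have "x <# ?F \<subseteq> ?F" using inv0[OF 1] c21 c x by (intro translate_conjugates) auto
      then have "x <# ?F = ?F" using fin cF x by (intro translate_eq_self)
      then show ?thesis by simp
    next
      case 2
      have "x <# (F2 <#> F1) \<subseteq> F2 <#> F1" using inv1[OF 2] c x by (intro translate_conjugates) auto
      then have "(x <# (F2 <#> F1)) <#> F0 \<subseteq> ?F" by (intro mono_set_mult) auto
      then have "x <# ?F \<subseteq> ?F" using c c21 x by (simp add: setmult_lcos_assoc)
      then have "x <# ?F = ?F" using fin cF x by (intro translate_eq_self)
      then show ?thesis by simp
    next
      case 3
      have "F1 <#> F0 \<subseteq> B" using F1 F0 subgroup.m_closed[OF B] by (fastforce simp: set_mult_def)
      then have inj: "inj_on (\<lambda>(a, b). a \<otimes> b) (F2 \<times> (F1 <#> F0))"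
        using F2 by (intro inj_on_subset[OF inj_on_complement_mult[OF A B AB]]) auto
      have "n * card (?F - (x <# ?F)) \<le> n * card (F2 - (x <# F2)) * card (F1 <#> F0)"
        using card_translate_diff_set_mult(1)[OF F2(1) c(1) fin(1) c10 inj x]
        by (simp add: assoc mult.assoc)
      also have "\<dots> \<le> card F2 * card (F1 <#> F0)" using inv2[OF 3] by simp
      also have "\<dots> = card ?F"
        using card_translate_diff_set_mult(2)[OF F2(1) c(1) fin(1) c10 inj x] by (simp add: assoc)
      finally show ?thesis .
    qed
  qed
  moreover have "real d / real c \<le> 1 / real n" if "n * d \<le> c" "0 < c" for c d
  proof -
    have "real n * real d \<le> real c" using that(1) by (metis of_nat_le_iff of_nat_mult)
    then show ?thesis using that(2) n by (simp add: field_simps)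
  qed
  moreover have "0 < card ?F" using fin ne by (simp add: card_gt_0_iff)
  ultimately show ?thesis unfolding Folner_set_def using fin ne cF by blast
qed

lemma subset_normal_closure: "K \<subseteq> carrier G \<Longrightarrow> K \<subseteq> normal_closure G K"
  unfolding normal_closure_def
proof
  fix k assume "K \<subseteq> carrier G" "k \<in> K"
  then have "k = \<one> \<otimes> k \<otimes> inv \<one>" by auto
  then show "k \<in> generate G {g \<otimes> k \<otimes> inv g |g k. g \<in> carrier G \<and> k \<in> K}"
    using \<open>k \<in> K\<close> by (intro generate.incl) blast
qed

lemma normal_conj_closed:
  assumes H: "subgroup H G" and N: "N \<lhd> subgroup_of G H" and "x \<in> N" "s \<in> H"
  shows "inv s \<otimes> x \<otimes> s \<in> N"
  using normal.inv_op_closed1[OF N, of s x] assms m_inv_consistent[OF H] by simp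

text \<open>The lists \<open>W2\<close>, \<open>W1\<close>, \<open>W0\<close> spell out words for \<open>F2\<close>, \<open>F1\<close>, \<open>F0\<close>. The complement of \<open>H2\<close> is
  \<open>N0 <#> N1\<close>: an element of it in \<open>H2\<close> has its \<open>N0\<close>-part in \<open>N0 \<inter> H\<close>, and what remains is in
  \<open>N1 \<inter> H2\<close>.\<close>

lemma kharlampovich_structure_computable_Folner_sets:
  assumes gen: "finite_generating_set G (L0 \<union> L1 \<union> L2)"
    and str: "kharlampovich_structure p G L0 L1 L2"
  shows "computable_Folner_sets G (L0 \<union> L1 \<union> L2)"
proof -
  let ?X = "L0 \<union> L1 \<union> L2"
  have fin: "finite L0" "finite L1" "finite L2" and X: "?X \<subseteq> carrier G"
    using gen by (auto simp: finite_generating_set_def)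
  define H H2 N0 N1 where "H = generate G (L1 \<union> L2)" and "H2 = generate G L2"
    and "N0 = normal_closure G (generate G L0)"
    and "N1 = normal_closure (subgroup_of G H) (generate G L1)"
  have ab2: "comm_group (subgroup_of G H2)"
    and N1: "comm_group (subgroup_of G N1)" "has_exponent (subgroup_of G N1) p"
    and semi1: "internal_semidirect (subgroup_of G H) N1 H2"
    and N0: "comm_group (subgroup_of G N0)" "has_exponent (subgroup_of G N0) p"
    and semi0: "internal_semidirect G N0 H"
    using str unfolding kharlampovich_structure_def Let_def H_def H2_def N0_def N1_def by auto
  have H: "subgroup H G" and H2: "subgroup H2 G"
    unfolding H_def H2_def using X by (auto intro!: generate_is_subgroup)
  interpret H: group "subgroup_of G H" by (rule subgroup_imp_group[OF H])
  have N0n: "N0 \<lhd> G" and N0H: "N0 \<inter> H = {\<one>}"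
    using semi0 by (auto simp: internal_semidirect_def)
  have N1n: "N1 \<lhd> subgroup_of G H" and N1H2: "N1 \<inter> H2 = {\<one>}"
    using semi1 by (auto simp: internal_semidirect_def)
  have N0s: "subgroup N0 G" by (rule normal_imp_subgroup[OF N0n])
  have N1H: "N1 \<subseteq> H" using subgroup.subset[OF normal_imp_subgroup[OF N1n]] by simp
  have N1s: "subgroup N1 G" by (rule incl_subgroup[OF H normal_imp_subgroup[OF N1n]])
  have H2H: "H2 \<subseteq> H" unfolding H_def H2_def by (rule mono_generate) auto
  have L1N1: "L1 \<subseteq> N1"
  proof -
    have "generate G L1 \<subseteq> H" unfolding H_def by (rule mono_generate) auto
    then have "generate G L1 \<subseteq> N1" unfolding N1_def by (intro H.subset_normal_closure) simp
    then show ?thesis by (auto intro: generate.incl)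
  qed
  have L0N0: "L0 \<subseteq> N0"
  proof -
    have "generate G L0 \<subseteq> N0" unfolding N0_def
      using X by (intro subset_normal_closure generate_incl) auto
    then show ?thesis by (auto intro: generate.incl)
  qed
  define B where "B = N0 <#> N1"
  have B: "subgroup B G" unfolding B_def by (rule mult_norm_subgroup[OF N0n N1s])
  have N1B: "N1 \<subseteq> B" and N0B: "N0 \<subseteq> B"
  proof -
    have c: "N0 \<subseteq> carrier G" "N1 \<subseteq> carrier G" by (rule subgroup.subset[OF N0s], rule subgroup.subset[OF N1s])
    show "N1 \<subseteq> B"
    proof
      fix b assume "b \<in> N1"
      then have "\<one> \<otimes> b \<in> B" unfolding B_def set_mult_def using subgroup.one_closed[OF N0s] by blast
      then show "b \<in> B" using \<open>b \<in> N1\<close> c by auto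
    qed
    show "N0 \<subseteq> B"
    proof
      fix a assume "a \<in> N0"
      then have "a \<otimes> \<one> \<in> B" unfolding B_def set_mult_def using subgroup.one_closed[OF N1s] by blast
      then show "a \<in> B" using \<open>a \<in> N0\<close> c by auto
    qed
  qed
  have H2B: "H2 \<inter> B = {\<one>}"
  proof -
    have "h = \<one>" if h: "h \<in> H2" "h \<in> B" for h
    proof -
      obtain a b where ab: "a \<in> N0" "b \<in> N1" "h = a \<otimes> b" using h(2) by (auto simp: B_def set_mult_def)
      have c: "a \<in> carrier G" "b \<in> carrier G" using ab subgroup.subset[OF N0s] subgroup.subset[OF N1s] by auto
      have "a = h \<otimes> inv b" using ab(3) c by (simp add: m_assoc)
      then have "a \<in> H"
        using subgroup.m_closed[OF H _ subgroup.m_inv_closed[OF H]] h(1) ab(2) H2H N1H by blast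
      then have "a = \<one>" using ab(1) N0H by auto
      then have "h \<in> N1" using ab c by simp
      then show ?thesis using h(1) N1H2 by auto
    qed
    moreover have "\<one> \<in> H2" "\<one> \<in> B"
      by (rule subgroup.one_closed[OF H2], rule subgroup.one_closed[OF B])
    ultimately show ?thesis by blast
  qed
  obtain xs0 xs1 xs2 where xs: "set xs0 = L0" "set xs1 = L1" "set xs2 = L2"
    using finite_list[OF fin(1)] finite_list[OF fin(2)] finite_list[OF fin(3)] by blast
  have xs2H2: "set xs2 \<subseteq> H2" by (auto simp: xs H2_def intro: generate.incl)
  obtain ds k where ds: "length ds = length xs2" "0 < k" and
    inv2: "\<And>x n. x \<in> set xs2 \<Longrightarrow> 0 < n \<Longrightarrow>
      n * card (box G (zip xs2 (map (bound (k * n)) ds)) - (x <# box G (zip xs2 (map (bound (k * n)) ds))))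
        \<le> card (box G (zip xs2 (map (bound (k * n)) ds)))"
    by (rule abelian_subgroup_Folner_boxes[OF H2 ab2 xs2H2]) (rule that)
  define letters where "letters xs = map (\<lambda>x. [(x, True)]) xs" for xs :: "'a list"
  define W2 where "W2 n = word_box (zip (letters xs2) (map (bound (k * n)) ds))" for n
  define Y1 where "Y1 n = conjugates (letters xs1) (W2 n)" for n
  define W1 where "W1 n = torsion_words p (Y1 n)" for n
  define Y0 where "Y0 n = conjugates (letters xs0) (products (W2 n) (W1 n))" for n
  define W0 where "W0 n = torsion_words p (Y0 n)" for n
  define W where "W n = products (products (W2 n) (W1 n)) (W0 n)" for n
  have "effective (\<lambda>n. n) (word_list_code ?X) W"
    unfolding word_list_code_list_code W_def W0_def Y0_def W1_def Y1_def W2_def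
    by (intro effective_products effective_torsion_words effective_conjugates effective_inv_letter
        effective_const effective_word_box effective_zip_bounds)
  then have comp: "computable (\<lambda>n. word_list_code ?X (W n))"
    by (rule computable_effective)
  have letters: "set (letters xs) \<subseteq> words ?X" "canonical_epi G ` set (letters xs) = set xs"
    if "set xs \<subseteq> ?X" for xs
  proof -
    show "set (letters xs) \<subseteq> words ?X" using that by (auto simp: letters_def)
    have "canonical_epi G [(x, True)] = x" if "x \<in> set xs" for x
      using that \<open>set xs \<subseteq> ?X\<close> X by (intro canonical_epi_generator) blast
    then show "canonical_epi G ` set (letters xs) = set xs" by (simp add: letters_def image_image)
  qed
  have letters0: "set (letters xs0) \<subseteq> words ?X" "canonical_epi G ` set (letters xs0) = L0"
    and letters1: "set (letters xs1) \<subseteq> words ?X" "canonical_epi G ` set (letters xs1) = L1"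
    using letters[of xs0] letters[of xs1] unfolding xs by blast+
  have "set (W n) \<subseteq> words ?X \<and> Folner_set G ?X n (canonical_epi G ` reduce ` set (W n))" if n: "1 \<le> n" for n
  proof -
    let ?f = "canonical_epi G"
    define F2 F1 F0 where "F2 = ?f ` set (W2 n)" and "F1 = ?f ` set (W1 n)" and "F0 = ?f ` set (W0 n)"
    have zip_letters: "zip (letters xs2) bs = map (\<lambda>(x, b). ([(x, True)], b)) (zip xs2 bs)" for bs :: "nat list"
      by (simp add: letters_def zip_map1)
    have W2: "set (W2 n) \<subseteq> words ?X" and F2_box: "F2 = box G (zip xs2 (map (bound (k * n)) ds))"
    proof -
      have sub: "fst ` set (zip (letters xs2) (map (bound (k * n)) ds)) \<subseteq> words ?X"
        using letters(1)[of xs2] xs by (auto dest!: set_zip_leftD)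
      show "set (W2 n) \<subseteq> words ?X" using canonical_epi_word_box[OF X sub] by (simp add: W2_def)
      have "map (\<lambda>y. (?f (fst y), snd y)) (zip (letters xs2) (map (bound (k * n)) ds))
          = zip xs2 (map (bound (k * n)) ds)"
        unfolding zip_letters map_map
        using xs X by (intro map_idI) (auto simp: canonical_epi_generator dest!: set_zip_leftD)
      then show "F2 = box G (zip xs2 (map (bound (k * n)) ds))"
        using canonical_epi_word_box[OF X sub] by (simp add: F2_def W2_def)
    qed
    have F2: "finite F2" "F2 \<noteq> {}" "F2 \<subseteq> H2"
    proof -
      show "F2 \<subseteq> H2" unfolding F2_box
        using xs2H2 by (intro box_subgroup[OF H2]) (auto dest!: set_zip_leftD)
      show "F2 \<noteq> {}" unfolding F2_box
        using ds(2) n by (intro box_nonempty) (auto simp: bound_def dest!: set_zip_rightD)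
    qed (simp add: F2_def)
    have Y1: "set (Y1 n) \<subseteq> words ?X" "?f ` set (Y1 n) = {inv s \<otimes> x \<otimes> s | x s. x \<in> L1 \<and> s \<in> F2}"
      unfolding Y1_def using canonical_epi_conjugates[OF X letters1(1) W2]
      by (simp_all only: F2_def letters1(2))
    have Y1N1: "?f ` set (Y1 n) \<subseteq> N1"
      unfolding Y1 using normal_conj_closed[OF H N1n] L1N1 F2(3) H2H by blast
    have W1: "set (W1 n) \<subseteq> words ?X" and F1_box: "F1 = box G (map (\<lambda>y. (y, p)) (map ?f (Y1 n)))"
      using canonical_epi_torsion_words[OF X Y1(1)] by (simp_all add: W1_def F1_def)
    have p: "0 < p" using N0(2) by (simp add: has_exponent_def)
    have F1: "finite F1" "F1 \<noteq> {}" "F1 \<subseteq> N1"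
    proof -
      show "F1 \<subseteq> N1" unfolding F1_box using Y1N1 by (intro box_subgroup[OF N1s]) auto
      show "F1 \<noteq> {}" unfolding F1_box using p by (intro box_nonempty) auto
    qed (simp add: F1_def)
    have W21: "set (products (W2 n) (W1 n)) \<subseteq> words ?X"
      and F21: "?f ` set (products (W2 n) (W1 n)) = F2 <#> F1"
      using words_products[OF X W2 W1] canonical_epi_products[OF X W2 W1] by (simp_all add: F2_def F1_def)
    have Y0: "set (Y0 n) \<subseteq> words ?X"
      "?f ` set (Y0 n) = {inv s \<otimes> x \<otimes> s | x s. x \<in> L0 \<and> s \<in> F2 <#> F1}"
      unfolding Y0_def using canonical_epi_conjugates[OF X letters0(1) W21]
      by (simp_all only: F21 letters0(2))
    have "F2 <#> F1 \<subseteq> carrier G"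
      using F2(3) F1(3) subgroup.subset[OF H2] subgroup.subset[OF N1s] by (intro set_mult_closed) auto
    then have Y0N0: "?f ` set (Y0 n) \<subseteq> N0"
      unfolding Y0 using normal.inv_op_closed1[OF N0n] L0N0 by blast
    have W0: "set (W0 n) \<subseteq> words ?X" and F0_box: "F0 = box G (map (\<lambda>y. (y, p)) (map ?f (Y0 n)))"
      using canonical_epi_torsion_words[OF X Y0(1)] by (simp_all add: W0_def F0_def)
    have F0: "finite F0" "F0 \<noteq> {}" "F0 \<subseteq> N0"
    proof -
      show "F0 \<subseteq> N0" unfolding F0_box using Y0N0 by (intro box_subgroup[OF N0s]) auto
      show "F0 \<noteq> {}" unfolding F0_box using p by (intro box_nonempty) auto
    qed (simp add: F0_def)
    have "Folner_set G ?X n ((F2 <#> F1) <#> F0)"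
    proof (rule Folner_set_tower[OF H2 B H2B n F2 F1(1,2) _ F0(1,2) _ X])
      show "F1 \<subseteq> B" "F0 \<subseteq> B" using F1(3) F0(3) N1B N0B by auto
      show "n * card (F2 - (x <# F2)) \<le> card F2" if "x \<in> L2" for x
        using inv2[of x n] that n xs by (simp add: F2_box)
      show "(inv s \<otimes> x \<otimes> s) <# F1 \<subseteq> F1" if "x \<in> L1" "s \<in> F2" for x s
        unfolding F1_box using that Y1(2) Y1N1
        by (intro translate_torsion_box_subgroup[OF N1s N1]) auto
      show "(inv s \<otimes> x \<otimes> s) <# F0 \<subseteq> F0" if "x \<in> L0" "s \<in> F2 <#> F1" for x s
        unfolding F0_box using that Y0(2) Y0N0
        by (intro translate_torsion_box_subgroup[OF N0s N0]) auto
    qed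
    moreover have WX: "set (W n) \<subseteq> words ?X" unfolding W_def by (rule words_products[OF X W21 W0])
    moreover have "?f ` reduce ` set (W n) = (F2 <#> F1) <#> F0"
    proof -
      have "?f ` reduce ` set (W n) = ?f ` set (W n)"
        unfolding image_image using canonical_epi_reduce[OF X] WX by (intro image_cong) auto
      also have "\<dots> = (F2 <#> F1) <#> F0"
        unfolding W_def using canonical_epi_products[OF X W21 W0] by (simp add: F21 F0_def)
      finally show ?thesis .
    qed
    ultimately show ?thesis by simp
  qed
  then show ?thesis unfolding computable_Folner_sets_def using comp by blast
qed

end

theorem theorem1:
  fixes M :: minsky_machine and p :: nat
    and G :: "('a, 'b) monoid_scheme" and L0 L1 L2 :: "'a set"
  assumes "is_minsky_machine M" and "\<not> decidable (halting_problem M)"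
    and "prime p"
    and "group G" and "finitely_presented G" and "solvable G"
    and "finite_generating_set G (L0 \<union> L1 \<union> L2)"
    and "L0 \<inter> L1 = {}" and "L0 \<inter> L2 = {}" and "L1 \<inter> L2 = {}"
    and "\<not> solvable_word_problem G (L0 \<union> L1 \<union> L2)"
    and "kharlampovich_structure p G L0 L1 L2"
  shows "computable_Folner_sets G (L0 \<union> L1 \<union> L2)"
  using group.kharlampovich_structure_computable_Folner_sets[OF assms(4,7,12)] .

end
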